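(* Let $M$ be a non-uniform matroid of rank $k$ on a ground set $E$ of size $n$. Then $$\widehat{\rho}(I(M)) \le \begin{cases} \dfrac{k(n-k)}{n-1} & \text{if } 2k\le n+1,\\[6pt] \dfrac{(k-1)(n-k+1)}{n-1} & \text{if } 2k\ge n+1, \end{cases} \qquad\text{and}\qquad \widehat{\rho}(I_{\Delta(M)}) \le \begin{cases} \dfrac{k(n-k)}{n-1} & \text{if } n\le 2k+1,\\[6pt] \dfrac{(n-k-1)(k+1)}{n-1} & \text{if } n\ge 2k+1. \end{cases}$$
   Context: Let $\mathbb{K}$ be a field, $S=\mathbb{K}[x_e : e\in E]$ the standard graded polynomial ring, and $x^U=\prod_{i\in U}x_i$ for $U\subseteq E$. For a squarefree monomial ideal $I\subseteq S$ and $s\ge 1$, the $s$-th symbolic power is $I^{(s)}=\bigcap_{P\in \mathrm{Min}(I)}P^s$, where $\mathrm{Min}(I)$ is the set of minimal primes of $I$. The asymptotic resurgence is $\widehat{\rho}(I)=\sup\{ s/r : s,r \text{ positive integers and } I^{(st)}\not\subseteq I^{rt}\text{ for all } t\gg 0\}$. For a matroid $M$ on $E$ with set of bases $\mathcal{B}(M)$ and set of circuits $\mathcal{C}(M)$, the facet ideal is $I(M)=\langle x^B : B\in\mathcal{B}(M)\rangle$, and the Stanley-Reisner ideal (of the independence complex $\Delta(M)$) is $I_{\Delta(M)}=\langle x^C : C\in\mathcal{C}(M)\rangle$. The uniform matroid of rank $k$ on $E$ has as bases all $k$-element subsets of $E$; $M$ is non-uniform if it is not of this form. *)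

theory Defs
  imports
    "HOL-Algebra.Ideal_Product"
    "HOL-Library.Poly_Mapping"
    "HOL-Library.Extended_Real"
begin

section \<open>Polynomial rings in a set of variables\<close>

text \<open>A monomial is a finitely supported exponent vector, a polynomial is a finitely supported map
  from monomials to coefficients, and multiplication is the convolution product of
  \<^theory>\<open>HOL-Library.Poly_Mapping\<close>.\<close>

type_synonym ('e, 'k) mpoly = "('e \<Rightarrow>\<^sub>0 nat) \<Rightarrow>\<^sub>0 'k"

text \<open>The ring \<open>\<bbbK>[x\<^sub>e : e \<in> E]\<close>, as a structure of \<open>HOL-Algebra\<close>; the coefficient field is the type
  \<open>'k\<close>, and only variables with index in \<open>E\<close> may occur.\<close>

definition mpoly_ring :: "'e set \<Rightarrow> ('e, 'k::field) mpoly ring" where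
  "mpoly_ring E =
     \<lparr>carrier = {p. \<forall>m \<in> Poly_Mapping.keys p. Poly_Mapping.keys m \<subseteq> E},
      mult = (*), one = 1, zero = 0, add = (+)\<rparr>"

definition mpoly_var :: "'e \<Rightarrow> ('e, 'k::field) mpoly" where
  "mpoly_var e = Poly_Mapping.single (Poly_Mapping.single e 1) 1"

definition sqfree_monom :: "'e set \<Rightarrow> ('e, 'k::field) mpoly" where
  "sqfree_monom U = (\<Prod>e\<in>U. mpoly_var e)"

lemma keys_uminus_mpoly: "Poly_Mapping.keys (- p) = Poly_Mapping.keys (p :: 'a \<Rightarrow>\<^sub>0 'b::ab_group_add)"
  by (auto simp: in_keys_iff)

lemma mpoly_ring_mult_closed:
  assumes "p \<in> carrier (mpoly_ring E)" "q \<in> carrier (mpoly_ring E)"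
  shows "p * q \<in> carrier (mpoly_ring E)"
proof -
  have "Poly_Mapping.keys m \<subseteq> E" if m: "m \<in> Poly_Mapping.keys (p * q)" for m
  proof -
    obtain a b where "m = a + b" "a \<in> Poly_Mapping.keys p" "b \<in> Poly_Mapping.keys q"
      using m keys_mult[of p q] by blast
    then show ?thesis
      using assms keys_add[of a b] unfolding mpoly_ring_def by fastforce
  qed
  then show ?thesis
    by (auto simp: mpoly_ring_def)
qed

lemma mpoly_ring_cring: "cring (mpoly_ring E :: ('e, 'k::field) mpoly ring)"
proof (rule cringI)
  show "abelian_group (mpoly_ring E :: ('e, 'k) mpoly ring)"
  proof (rule abelian_groupI)
    fix x y :: "('e, 'k) mpoly"
    assume "x \<in> carrier (mpoly_ring E)" "y \<in> carrier (mpoly_ring E)"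
    then show "x \<oplus>\<^bsub>mpoly_ring E\<^esub> y \<in> carrier (mpoly_ring E)"
      using keys_add[of x y] by (auto simp: mpoly_ring_def)
  next
    fix x :: "('e, 'k) mpoly"
    assume x: "x \<in> carrier (mpoly_ring E)"
    show "\<exists>y\<in>carrier (mpoly_ring E). y \<oplus>\<^bsub>mpoly_ring E\<^esub> x = \<zero>\<^bsub>mpoly_ring E\<^esub>"
      using x by (intro bexI[of _ "- x"]) (auto simp: mpoly_ring_def keys_uminus_mpoly)
  qed (auto simp: mpoly_ring_def algebra_simps)
  show "comm_monoid (mpoly_ring E :: ('e, 'k) mpoly ring)"
  proof (rule comm_monoidI)
    fix x y :: "('e, 'k) mpoly"
    assume "x \<in> carrier (mpoly_ring E)" "y \<in> carrier (mpoly_ring E)"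
    then show "x \<otimes>\<^bsub>mpoly_ring E\<^esub> y \<in> carrier (mpoly_ring E)"
      using mpoly_ring_mult_closed[of x E y] by (simp add: mpoly_ring_def)
  qed (auto simp: mpoly_ring_def algebra_simps)
qed (auto simp: mpoly_ring_def algebra_simps)

lemma sqfree_monom_closed:
  assumes "U \<subseteq> E"
  shows "sqfree_monom U \<in> carrier (mpoly_ring E :: ('e, 'k::field) mpoly ring)"
  unfolding sqfree_monom_def using assms
proof (induction U rule: infinite_finite_induct)
  case (insert x F)
  then have "mpoly_var x \<in> carrier (mpoly_ring E :: ('e, 'k) mpoly ring)"
    by (auto simp: mpoly_ring_def mpoly_var_def)
  with insert show ?case
    by (auto intro: mpoly_ring_mult_closed)
qed (auto simp: mpoly_ring_def)


section \<open>Symbolic powers and asymptotic resurgence\<close>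

definition ideal_power :: "('a, 'b) ring_scheme \<Rightarrow> 'a set \<Rightarrow> nat \<Rightarrow> 'a set" where
  "ideal_power R I r = I [^]\<^bsub>ideals_set R\<^esub> r"

definition minimal_primes :: "('a, 'b) ring_scheme \<Rightarrow> 'a set \<Rightarrow> 'a set set" where
  "minimal_primes R I =
     {P. primeideal P R \<and> I \<subseteq> P \<and> (\<forall>Q. primeideal Q R \<and> I \<subseteq> Q \<and> Q \<subseteq> P \<longrightarrow> Q = P)}"

text \<open>This is the symbolic power for squarefree monomial (more generally, radical) ideals of a
  polynomial ring over a field. Intersecting with the carrier only matters for the unit ideal,
  which has no minimal primes.\<close>

definition symbolic_power :: "('a, 'b) ring_scheme \<Rightarrow> 'a set \<Rightarrow> nat \<Rightarrow> 'a set" where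
  "symbolic_power R I s = carrier R \<inter> (\<Inter>P\<in>minimal_primes R I. ideal_power R P s)"

text \<open>The supremum is taken in the extended reals, so that an upper bound on it also asserts that the
  set of quotients is bounded.\<close>

definition asymptotic_resurgence :: "('a, 'b) ring_scheme \<Rightarrow> 'a set \<Rightarrow> ereal" where
  "asymptotic_resurgence R I =
     Sup {ereal (real s / real r) | s r. s > 0 \<and> r > 0 \<and>
            (\<forall>\<^sub>F t in sequentially. \<not> symbolic_power R I (s * t) \<subseteq> ideal_power R I (r * t))}"


section \<open>Matroids and their ideals\<close>

locale matroid =
  fixes E :: "'e set" and indep :: "'e set \<Rightarrow> bool"
  assumes finite_ground: "finite E"
    and indep_subset_ground: "indep X \<Longrightarrow> X \<subseteq> E"
    and indep_empty: "indep {}"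
    and indep_subset: "indep X \<Longrightarrow> Y \<subseteq> X \<Longrightarrow> indep Y"
    and indep_augment:
      "indep X \<Longrightarrow> indep Y \<Longrightarrow> card X < card Y \<Longrightarrow> \<exists>y\<in>Y - X. indep (insert y X)"

definition matroid_bases :: "('e set \<Rightarrow> bool) \<Rightarrow> 'e set set" where
  "matroid_bases indep = {B. indep B \<and> (\<forall>X. indep X \<and> B \<subseteq> X \<longrightarrow> X = B)}"

definition matroid_circuits :: "'e set \<Rightarrow> ('e set \<Rightarrow> bool) \<Rightarrow> 'e set set" where
  "matroid_circuits E indep = {C. C \<subseteq> E \<and> \<not> indep C \<and> (\<forall>D. D \<subset> C \<longrightarrow> indep D)}"

definition matroid_rank :: "('e set \<Rightarrow> bool) \<Rightarrow> nat" where
  "matroid_rank indep = Max (card ` {X. indep X})"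

definition uniform_matroid :: "'e set \<Rightarrow> ('e set \<Rightarrow> bool) \<Rightarrow> bool" where
  "uniform_matroid E indep \<longleftrightarrow> (\<exists>k. matroid_bases indep = {B. B \<subseteq> E \<and> card B = k})"

lemma (in matroid) bases_eq: "matroid_bases indep = {B. indep B \<and> card B = matroid_rank indep}"
proof -
  have fin: "finite {X. indep X}"
    by (rule finite_subset[of _ "Pow E"]) (use indep_subset_ground finite_ground in auto)
  have le: "card X \<le> matroid_rank indep" if "indep X" for X
    unfolding matroid_rank_def using fin that by (intro Max_ge) auto
  have "matroid_rank indep \<in> card ` {X. indep X}"
    unfolding matroid_rank_def using fin indep_empty by (intro Max_in) auto
  then obtain Y where Y: "indep Y" "card Y = matroid_rank indep"
    by auto
  show ?thesis
  proof (intro equalityI subsetI)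
    fix B assume B: "B \<in> matroid_bases indep"
    have "\<not> card B < card Y"
    proof
      assume "card B < card Y"
      then obtain y where "y \<in> Y - B" "indep (insert y B)"
        using indep_augment[of B Y] B Y by (auto simp: matroid_bases_def)
      then show False
        using B by (auto simp: matroid_bases_def)
    qed
    then show "B \<in> {B. indep B \<and> card B = matroid_rank indep}"
      using B Y le[of B] by (auto simp: matroid_bases_def)
  next
    fix B assume B: "B \<in> {B. indep B \<and> card B = matroid_rank indep}"
    have "X = B" if "indep X" "B \<subseteq> X" for X
      using that B le[of X] finite_subset[OF indep_subset_ground finite_ground, of X]
      by (metis (mono_tags, lifting) card_seteq mem_Collect_eq)
    then show "B \<in> matroid_bases indep"
      using B by (auto simp: matroid_bases_def)
  qed
qed

definition facet_ideal :: "'e set \<Rightarrow> ('e set \<Rightarrow> bool) \<Rightarrow> ('e, 'k::field) mpoly set" where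
  "facet_ideal E indep = genideal (mpoly_ring E) (sqfree_monom ` matroid_bases indep)"

text \<open>The circuits are the minimal non-faces of the independence complex.\<close>

definition stanley_reisner_ideal :: "'e set \<Rightarrow> ('e set \<Rightarrow> bool) \<Rightarrow> ('e, 'k::field) mpoly set" where
  "stanley_reisner_ideal E indep = genideal (mpoly_ring E) (sqfree_monom ` matroid_circuits E indep)"

end

theory Submission
  imports Defs
begin

text \<open>For a squarefree monomial ideal with generators \<open>x\<^sup>B\<close>, \<open>B \<in> F\<close>, a monomial \<open>x\<^sup>a\<close> in the \<open>m\<close>-th symbolic
  power satisfies \<open>a(T) \<ge> m\<close> for each set \<open>T\<close> meeting all members of \<open>F\<close>, and it lies in the \<open>q\<close>-th power
  as soon as \<open>q\<close> members of \<open>F\<close> pack into \<open>a\<close>. By linear programming duality and rounding down, such a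
  packing exists if \<open>a \<cdot> w \<ge> q + card F\<close> for each weight \<open>w \<ge> 0\<close> with \<open>w(B) \<ge> 1\<close> on \<open>F\<close>. So \<open>\<rho>\<close> bounds the
  asymptotic resurgence once \<open>m \<le> \<rho> (a \<cdot> w)\<close> for all such \<open>a\<close> and \<open>w\<close>; the additive error vanishes
  asymptotically.

  For the bases of a matroid, compare \<open>w\<close> with a basis of minimal weight, level set by level set: it
  suffices that \<open>m \<cdot> rk(M / (E - A)) \<le> \<rho> \<cdot> a(A)\<close> for each level set \<open>A\<close>. For \<open>A \<noteq> E\<close> the contraction has
  smaller rank or corank than \<open>M\<close>, and the value of a uniform matroid suffices; for \<open>A = E\<close> a missing
  basis gains what is needed. The condition on \<open>a\<close> and \<open>w\<close> is symmetric under passing to the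
  blocker, which turns circuits into bases of the dual matroid.\<close>

section \<open>Packing and linear programming duality\<close>

text \<open>Bartl's induction: if discarding the constraint \<open>j\<close> breaks the implication, then some \<open>z\<close> violates
  only that constraint, and projecting along \<open>z\<close> onto the kernel of \<open>v j\<close> reduces to the remaining
  constraints.\<close>

lemma farkas:
  fixes v :: "'i \<Rightarrow> 'x \<Rightarrow> real" and b :: "'x \<Rightarrow> real"
  assumes "finite I" and "finite X"
    and "\<And>y. (\<And>i. i \<in> I \<Longrightarrow> 0 \<le> (\<Sum>x\<in>X. v i x * y x)) \<Longrightarrow> 0 \<le> (\<Sum>x\<in>X. b x * y x)"
  shows "\<exists>u. (\<forall>i\<in>I. 0 \<le> u i) \<and> (\<forall>x\<in>X. b x = (\<Sum>i\<in>I. u i * v i x))"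
  using assms(1,3)
proof (induction I arbitrary: v b rule: finite_induct)
  case empty
  \<comment> \<open>With no constraints left, the test vector \<open>- b\<close> forces
    \<open>b\<close> to vanish on \<open>X\<close>.\<close>
  have "0 \<le> (\<Sum>x\<in>X. b x * (- b x))"
    by (rule empty) simp
  then have "(\<Sum>x\<in>X. b x * b x) \<le> 0"
    by (simp add: sum_negf)
  then have "(\<Sum>x\<in>X. b x * b x) = 0"
    by (intro antisym sum_nonneg) auto
  then have "\<forall>x\<in>X. b x = 0"
    using sum_nonneg_eq_0_iff[OF assms(2), of "\<lambda>x. b x * b x"] by auto
  then show ?case by auto
next
  case (insert j I)
  define D where "D f g = (\<Sum>x\<in>X. f x * g x)" for f g :: "'x \<Rightarrow> real"
  have D_diff_left: "D (\<lambda>x. f x - c * g x) h = D f h - c * D g h" for f g h c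
    by (simp add: D_def algebra_simps sum_subtractf sum_distrib_left)
  have D_diff_right: "D h (\<lambda>x. f x - c * g x) = D h f - c * D h g" for f g h c
    by (simp add: D_def algebra_simps sum_subtractf sum_distrib_left)
  have prem: "0 \<le> D b y" if "0 \<le> D (v j) y" "\<And>i. i \<in> I \<Longrightarrow> 0 \<le> D (v i) y" for y
    using insert.prems[of y] that unfolding D_def by blast
  show ?case
  proof (cases "\<forall>y. (\<forall>i\<in>I. 0 \<le> D (v i) y) \<longrightarrow> 0 \<le> D b y")
    case True
    then obtain u where u: "\<forall>i\<in>I. 0 \<le> u i" "\<forall>x\<in>X. b x = (\<Sum>i\<in>I. u i * v i x)"
      using insert.IH[of v b] unfolding D_def by blast
    have "(\<Sum>i\<in>insert j I. (u(j := 0)) i * v i x) = (\<Sum>i\<in>I. u i * v i x)" for x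
      using insert.hyps by (auto intro!: sum.cong)
    with u show ?thesis
      by (intro exI[of _ "u(j := 0)"]) auto
  next
    case False
    then obtain z where z: "\<And>i. i \<in> I \<Longrightarrow> 0 \<le> D (v i) z" "D b z < 0"
      by (auto simp: not_le)
    define c where "c = D (v j) z"
    have c: "c < 0"
      using prem[of z] z unfolding c_def by fastforce
    define w where "w i = (\<lambda>x. v i x - (D (v i) z / c) * v j x)" for i
    define d where "d = (\<lambda>x. b x - (D b z / c) * v j x)"
    have "0 \<le> D d y" if y: "\<And>i. i \<in> I \<Longrightarrow> 0 \<le> D (w i) y" for y
    proof -
      define y' where "y' = (\<lambda>x. y x - (D (v j) y / c) * z x)"
      have "D (v j) y' = 0"
        unfolding y'_def D_diff_right c_def[symmetric] using c by simp
      moreover have "D (v i) y' = D (w i) y" for i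
        unfolding y'_def w_def D_diff_right D_diff_left by simp
      moreover have "D b y' = D d y"
        unfolding y'_def d_def D_diff_right D_diff_left by simp
      ultimately show ?thesis
        using prem[of y'] y by simp
    qed
    then obtain u where u: "\<forall>i\<in>I. 0 \<le> u i" "\<forall>x\<in>X. d x = (\<Sum>i\<in>I. u i * w i x)"
      using insert.IH[of w d] unfolding D_def by blast
    \<comment> \<open>The coefficient of \<open>v j\<close> left after undoing the projection. It is
      nonnegative because \<open>D b z\<close> and \<open>c\<close> are negative while no
      \<open>D (v i) z\<close> with \<open>i \<in> I\<close> is.\<close>
    define t where "t = D b z / c - (\<Sum>i\<in>I. u i * (D (v i) z / c))"
    have "(\<Sum>i\<in>I. u i * (D (v i) z / c)) \<le> 0"
      using u(1) z(1) c by (intro sum_nonpos mult_nonneg_nonpos divide_nonneg_neg) auto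
    then have "0 \<le> t"
      using divide_neg_neg[OF z(2) c] by (simp add: t_def)
    moreover have "b x = (\<Sum>i\<in>insert j I. (u(j := t)) i * v i x)" if "x \<in> X" for x
    proof -
      have "b x = d x + (D b z / c) * v j x"
        by (simp add: d_def)
      also have "d x = (\<Sum>i\<in>I. u i * v i x) - (\<Sum>i\<in>I. u i * (D (v i) z / c)) * v j x"
        using u(2) that by (simp add: w_def algebra_simps sum_subtractf sum_distrib_left)
      finally have "b x = (\<Sum>i\<in>I. u i * v i x) + t * v j x"
        by (simp add: t_def algebra_simps)
      moreover have "(\<Sum>i\<in>I. (u(j := t)) i * v i x) = (\<Sum>i\<in>I. u i * v i x)"
        using insert.hyps by (auto intro!: sum.cong)
      ultimately show ?thesis
        using insert.hyps by simp
    qed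
    ultimately show ?thesis
      using u(1) by (intro exI[of _ "u(j := t)"]) auto
  qed
qed

text \<open>Linear programming duality, homogenised so that \<open>farkas\<close> applies: the
  multipliers of the constraints \<open>Inr B\<close> form the packing, those of
  \<open>Inl e\<close> are the capacity left over at \<open>e\<close>.\<close>

lemma fractional_packing:
  fixes a :: "'e \<Rightarrow> real" and q :: real
  assumes fin: "finite E" "finite F" and sub: "\<And>B. B \<in> F \<Longrightarrow> B \<subseteq> E"
    and a: "\<And>e. e \<in> E \<Longrightarrow> 0 \<le> a e" and q: "0 \<le> q"
    and cover: "\<And>w. (\<And>e. e \<in> E \<Longrightarrow> 0 \<le> w e) \<Longrightarrow> (\<And>B. B \<in> F \<Longrightarrow> 1 \<le> sum w B) \<Longrightarrow>
      q \<le> (\<Sum>e\<in>E. a e * w e)"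
  shows "\<exists>l. (\<forall>B\<in>F. 0 \<le> l B) \<and> sum l F = q \<and> (\<forall>e\<in>E. (\<Sum>B\<in>{B \<in> F. e \<in> B}. l B) \<le> a e)"
proof -
  define X where "X = insert None (Some ` E)"
  \<comment> \<open>The coordinate \<open>None\<close> is the homogenising variable:
    \<open>Inl e\<close> encodes \<open>0 \<le> y (Some e)\<close>, and \<open>Inr B\<close> encodes
    that \<open>B\<close> has weight at least \<open>y None\<close>. Dividing by a positive
    \<open>y None\<close> thus yields an admissible \<open>w\<close>.\<close>
  define v :: "'e + 'e set \<Rightarrow> 'e option \<Rightarrow> real" where
    "v i x = (case i of Inl e \<Rightarrow> of_bool (x = Some e)
      | Inr B \<Rightarrow> (case x of None \<Rightarrow> -1 | Some e \<Rightarrow> of_bool (e \<in> B)))" for i x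
  define b where "b x = (case x of None \<Rightarrow> -q | Some e \<Rightarrow> a e)" for x
  have sumX: "(\<Sum>x\<in>X. g x) = g None + (\<Sum>e\<in>E. g (Some e))" for g :: "'e option \<Rightarrow> real"
    using fin(1) by (simp add: X_def sum.reindex)
  have "\<exists>u. (\<forall>i\<in>(Inl ` E \<union> Inr ` F). 0 \<le> u i) \<and> (\<forall>x\<in>X. b x = (\<Sum>i\<in>(Inl ` E \<union> Inr ` F). u i * v i x))"
  proof (rule farkas)
    fix y assume y: "\<And>i. i \<in> Inl ` E \<union> Inr ` F \<Longrightarrow> 0 \<le> (\<Sum>x\<in>X. v i x * y x)"
    define w where "w e = y (Some e)" for e
    have w: "0 \<le> w e" if "e \<in> E" for e
      using y[of "Inl e"] that fin(1) by (simp add: sumX v_def w_def)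
    have yB: "y None \<le> sum w B" if "B \<in> F" for B
    proof -
      have "(\<Sum>e\<in>E. of_bool (e \<in> B) * w e) = sum w B"
        using sub[OF that] fin(1) by (simp add: Int_absorb1 flip: sum.inter_restrict)
      then show ?thesis
        using y[of "Inr B"] that by (simp add: sumX v_def w_def)
    qed
    have "q * y None \<le> (\<Sum>e\<in>E. a e * w e)"
    proof (cases "0 < y None")
      case True
      have "q \<le> (\<Sum>e\<in>E. a e * (w e / y None))"
        using True w yB by (intro cover) (auto simp: field_simps simp flip: sum_divide_distrib)
      also have "\<dots> = (\<Sum>e\<in>E. a e * w e) / y None"
        by (simp add: sum_divide_distrib)
      finally show ?thesis
        using True by (simp add: field_simps)
    next
      case False
      then have "q * y None \<le> 0"
        using q by (simp add: mult_nonneg_nonpos)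
      also have "0 \<le> (\<Sum>e\<in>E. a e * w e)"
        using a w by (intro sum_nonneg) auto
      finally show ?thesis .
    qed
    then show "0 \<le> (\<Sum>x\<in>X. b x * y x)"
      by (simp add: sumX b_def w_def)
  qed (use fin in \<open>auto simp: X_def\<close>)
  then obtain u where u: "\<forall>i\<in>(Inl ` E \<union> Inr ` F). 0 \<le> u i" "\<forall>x\<in>X. b x = (\<Sum>i\<in>(Inl ` E \<union> Inr ` F). u i * v i x)"
    by blast
  have uX: "b x = (\<Sum>e\<in>E. u (Inl e) * v (Inl e) x) + (\<Sum>B\<in>F. u (Inr B) * v (Inr B) x)"
    if "x \<in> X" for x
  proof -
    have "Inl ` E \<inter> Inr ` F = {}"
      by auto
    then show ?thesis
      using u(2) that fin by (simp add: sum.union_disjoint sum.reindex)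
  qed
  have "sum (u \<circ> Inr) F = q"
    using uX[of None] by (simp add: X_def b_def v_def sum_negf)
  moreover have "(\<Sum>B\<in>{B \<in> F. e \<in> B}. (u \<circ> Inr) B) \<le> a e" if "e \<in> E" for e
  proof -
    have "a e = u (Inl e) + (\<Sum>B\<in>F. if e \<in> B then u (Inr B) else 0)"
      using uX[of "Some e"] that fin(1) by (simp add: X_def b_def v_def of_bool_def if_distrib cong: if_cong)
    then show ?thesis
      using u(1) that fin(2) by (auto simp: sum.inter_filter)
  qed
  moreover have "\<forall>B\<in>F. 0 \<le> (u \<circ> Inr) B"
    using u(1) by auto
  ultimately show ?thesis
    by (intro exI[of _ "u \<circ> Inr"]) auto
qed

text \<open>Rounding down a fractional packing of size \<open>q + card F\<close> loses at most one
  per member of \<open>F\<close> and keeps all capacities.\<close>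

lemma integer_packing:
  fixes a :: "'e \<Rightarrow> nat" and q :: nat
  assumes fin: "finite E" "finite F" and sub: "\<And>B. B \<in> F \<Longrightarrow> B \<subseteq> E"
    and cover: "\<And>w. (\<And>e. e \<in> E \<Longrightarrow> 0 \<le> w e) \<Longrightarrow> (\<And>B. B \<in> F \<Longrightarrow> 1 \<le> sum w B) \<Longrightarrow>
      real (q + card F) \<le> (\<Sum>e\<in>E. real (a e) * w e)"
  shows "\<exists>f :: 'e set \<Rightarrow> nat. q \<le> sum f F \<and> (\<forall>e\<in>E. (\<Sum>B\<in>{B \<in> F. e \<in> B}. f B) \<le> a e)"
proof -
  have "\<exists>l. (\<forall>B\<in>F. 0 \<le> l B) \<and> sum l F = real (q + card F) \<and>
      (\<forall>e\<in>E. (\<Sum>B\<in>{B \<in> F. e \<in> B}. l B) \<le> real (a e))"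
    by (rule fractional_packing[OF fin]) (fact sub | fact cover | simp)+
  then obtain l where l: "\<forall>B\<in>F. 0 \<le> l B" "sum l F = real (q + card F)"
      "\<forall>e\<in>E. (\<Sum>B\<in>{B \<in> F. e \<in> B}. l B) \<le> real (a e)"
    by blast
  define f where "f B = nat \<lfloor>l B\<rfloor>" for B
  have f: "real (f B) \<le> l B" "l B \<le> real (f B) + 1" if "B \<in> F" for B
    using l(1) that by (auto simp: f_def)
  have "real (q + card F) \<le> (\<Sum>B\<in>F. real (f B) + 1)"
    unfolding l(2)[symmetric] using f by (intro sum_mono) auto
  then have "real (q + card F) \<le> real (sum f F + card F)"
    by (simp add: sum.distrib)
  then have "q \<le> sum f F"
    by linarith
  moreover have "(\<Sum>B\<in>{B \<in> F. e \<in> B}. f B) \<le> a e" if "e \<in> E" for e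
  proof -
    have "real (\<Sum>B\<in>{B \<in> F. e \<in> B}. f B) \<le> (\<Sum>B\<in>{B \<in> F. e \<in> B}. l B)"
      unfolding of_nat_sum using f by (intro sum_mono) auto
    also have "\<dots> \<le> real (a e)"
      using l(3) that by blast
    finally show ?thesis
      by linarith
  qed
  ultimately show ?thesis
    by blast
qed

section \<open>Powers and symbolic powers of squarefree monomial ideals\<close>

text \<open>The index type carries no order, hence there is no monomial order; this lemma provides the
  uncancelled term in a product of polynomials instead.\<close>

lemma unique_sum:
  fixes A B :: "('e \<Rightarrow>\<^sub>0 nat) set"
  assumes "finite A" "finite B" "A \<noteq> {}" "B \<noteq> {}"
  shows "\<exists>a\<in>A. \<exists>b\<in>B. \<forall>a'\<in>A. \<forall>b'\<in>B. a' + b' = a + b \<longrightarrow> a' = a \<and> b' = b"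
  using assms
proof (induction "card A + card B" arbitrary: A B rule: less_induct)
  case less
  \<comment> \<open>\<open>top e X\<close> is the face of \<open>X\<close> of highest degree in the
    variable \<open>e\<close>. Degrees add, so a sum of two elements of faces can only be matched by
    elements of the same faces.\<close>
  define top where "top e X = {x \<in> X. \<forall>y\<in>X. Poly_Mapping.lookup y e \<le> Poly_Mapping.lookup x e}" for e and X :: "('e \<Rightarrow>\<^sub>0 nat) set"
  have top_sub: "top e X \<subseteq> X" for e X
    by (auto simp: top_def)
  have top_ne: "top e X \<noteq> {}" if "finite X" "X \<noteq> {}" for e X
  proof -
    have "Max ((\<lambda>x. Poly_Mapping.lookup x e) ` X) \<in> (\<lambda>x. Poly_Mapping.lookup x e) ` X"
      using that by simp
    then obtain x where "x \<in> X" "Poly_Mapping.lookup x e = Max ((\<lambda>x. Poly_Mapping.lookup x e) ` X)"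
      by auto
    then have "x \<in> top e X"
      using that by (simp add: top_def)
    then show ?thesis by blast
  qed
  show ?case
  proof (cases "\<exists>e. top e A \<noteq> A \<or> top e B \<noteq> B")
    case True
    then obtain e where e: "top e A \<noteq> A \<or> top e B \<noteq> B"
      by blast
    have "card (top e A) \<le> card A" "card (top e B) \<le> card B"
      using less.prems top_sub by (simp_all add: card_mono)
    moreover have "card (top e A) < card A \<or> card (top e B) < card B"
      using e less.prems top_sub[of e A] top_sub[of e B] by (metis psubsetI psubset_card_mono)
    ultimately have "card (top e A) + card (top e B) < card A + card B"
      by linarith
    then obtain a b where ab: "a \<in> top e A" "b \<in> top e B"
        "\<forall>a'\<in>top e A. \<forall>b'\<in>top e B. a' + b' = a + b \<longrightarrow> a' = a \<and> b' = b"
      using less.hyps[of "top e A" "top e B"] less.prems top_ne finite_subset[OF top_sub] by metis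
    have "a' = a \<and> b' = b" if "a' \<in> A" "b' \<in> B" and eq: "a' + b' = a + b" for a' b'
    proof -
      have "Poly_Mapping.lookup a' e \<le> Poly_Mapping.lookup a e" "Poly_Mapping.lookup b' e \<le> Poly_Mapping.lookup b e"
        using ab that by (auto simp: top_def)
      moreover have "Poly_Mapping.lookup a' e + Poly_Mapping.lookup b' e = Poly_Mapping.lookup a e + Poly_Mapping.lookup b e"
        using eq by (metis lookup_add)
      ultimately have "Poly_Mapping.lookup a' e = Poly_Mapping.lookup a e" "Poly_Mapping.lookup b' e = Poly_Mapping.lookup b e"
        by linarith+
      then have "a' \<in> top e A" "b' \<in> top e B"
        using ab that by (auto simp: top_def)
      with ab eq show ?thesis by blast
    qed
    with ab top_sub show ?thesis by blast
  next
    case False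
    \<comment> \<open>If no face is proper, every exponent is constant on \<open>A\<close> and on
      \<open>B\<close>, so both are singletons.\<close>
    have "x = y" if "x \<in> X" "y \<in> X" "\<And>e. top e X = X" for x y X
      using that by (intro poly_mapping_eqI) (metis (mono_tags, lifting) antisym mem_Collect_eq top_def)
    with False less.prems show ?thesis
      by (metis ex_in_conv)
  qed
qed

section \<open>Exponent vectors and ideals of the polynomial ring\<close>

lemma keys_add_nat: "Poly_Mapping.keys (a + b) = Poly_Mapping.keys a \<union> Poly_Mapping.keys b" for a b :: "'e \<Rightarrow>\<^sub>0 nat"
  by (auto simp: in_keys_iff lookup_add)

definition sqfree_exponent :: "'e set \<Rightarrow> ('e \<Rightarrow>\<^sub>0 nat)" where
  "sqfree_exponent U = (\<Sum>e\<in>U. Poly_Mapping.single e 1)"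

lemma lookup_sqfree_exponent: "finite U \<Longrightarrow> Poly_Mapping.lookup (sqfree_exponent U) e = of_bool (e \<in> U)"
  by (simp add: sqfree_exponent_def lookup_sum lookup_single when_def of_bool_def)

lemma keys_sqfree_exponent: "finite U \<Longrightarrow> Poly_Mapping.keys (sqfree_exponent U) = U"
  by (auto simp: in_keys_iff lookup_sqfree_exponent)

lemma sqfree_monom_eq_single: "finite U \<Longrightarrow> sqfree_monom U = Poly_Mapping.single (sqfree_exponent U) 1"
  unfolding sqfree_monom_def sqfree_exponent_def
  by (induction U rule: finite_induct) (simp_all add: mpoly_var_def mult_single)

lemma ideal_power_0: "ideal_power R I 0 = carrier R"
  by (simp add: ideal_power_def nat_pow_def ideals_set_def)

lemma ideal_power_Suc: "ideal_power R I (Suc r) = ideal_prod R (ideal_power R I r) I"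
  by (simp add: ideal_power_def nat_pow_def ideals_set_def)

lemma (in ring) ideal_ideal_power: "ideal I R \<Longrightarrow> ideal (ideal_power R I r) R"
  by (induction r) (simp_all add: ideal_power_0 ideal_power_Suc oneideal ideal_prod_is_ideal)

lemma mpoly_ring_simps:
  "mult (mpoly_ring E) = (*)" "one (mpoly_ring E) = 1"
  "zero (mpoly_ring E) = 0" "add (mpoly_ring E) = (+)"
  by (simp_all add: mpoly_ring_def)

lemma mpoly_ring_carrier_iff: "p \<in> carrier (mpoly_ring E) \<longleftrightarrow> (\<forall>m\<in>Poly_Mapping.keys p. Poly_Mapping.keys m \<subseteq> E)"
  by (simp add: mpoly_ring_def)

lemma mpoly_ring_a_inv:
  assumes "p \<in> carrier (mpoly_ring E)"
  shows "\<ominus>\<^bsub>mpoly_ring E\<^esub> p = - (p :: ('e, 'k::field) mpoly)"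
proof -
  interpret cring "mpoly_ring E :: ('e, 'k) mpoly ring"
    by (rule mpoly_ring_cring)
  show ?thesis
    using assms by (intro minus_equality) (auto simp: mpoly_ring_simps mpoly_ring_carrier_iff keys_uminus_mpoly)
qed

text \<open>A polynomial is the sum of its terms. This reduces membership in a power of the ideal to
  single monomials, to which packings apply.\<close>

lemma ideal_memI_monomials:
  fixes p :: "('e, 'k::field) mpoly"
  assumes "ideal Q (mpoly_ring E)"
    and "\<And>m. m \<in> Poly_Mapping.keys p \<Longrightarrow> Poly_Mapping.single m (Poly_Mapping.lookup p m) \<in> Q"
  shows "p \<in> Q"
proof -
  interpret ideal Q "mpoly_ring E"
    by fact
  have "(\<Sum>m\<in>K. Poly_Mapping.single m (Poly_Mapping.lookup p m)) \<in> Q" if "finite K" "K \<subseteq> Poly_Mapping.keys p" for K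
    using that
  proof (induction K rule: finite_induct)
    case empty
    then show ?case
      using additive_subgroup.zero_closed[OF is_additive_subgroup] by (simp add: mpoly_ring_simps)
  next
    case (insert m K)
    then show ?case
      using additive_subgroup.a_closed[OF is_additive_subgroup, of "Poly_Mapping.single m (Poly_Mapping.lookup p m)"] assms(2)[of m] by (simp add: mpoly_ring_simps)
  qed
  moreover have "(\<Sum>m\<in>Poly_Mapping.keys p. Poly_Mapping.single m (Poly_Mapping.lookup p m)) = p"
    by (intro poly_mapping_eqI) (auto simp: lookup_sum lookup_single when_def in_keys_iff)
  ultimately show ?thesis
    using finite_keys[of p] by (metis order_refl)
qed

section \<open>Prime ideals generated by variables\<close>

definition variable_ideal :: "'e set \<Rightarrow> 'e set \<Rightarrow> ('e, 'k::field) mpoly set" where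
  "variable_ideal E T = {p \<in> carrier (mpoly_ring E). \<forall>m\<in>Poly_Mapping.keys p. Poly_Mapping.keys m \<inter> T \<noteq> {}}"

lemma ideal_variable_ideal: "ideal (variable_ideal E T :: ('e, 'k::field) mpoly set) (mpoly_ring E)"
proof -
  let ?P = "variable_ideal E T :: ('e, 'k) mpoly set"
  interpret cring "mpoly_ring E :: ('e, 'k) mpoly ring"
    by (rule mpoly_ring_cring)
  have mult: "x * p \<in> ?P" if "p \<in> ?P" "x \<in> carrier (mpoly_ring E)" for p x
    using that mpoly_ring_mult_closed[of x E p] keys_mult[of x p]
    by (fastforce simp: variable_ideal_def keys_add_nat)
  show ?thesis
  proof (rule idealI[OF ring_axioms])
    show "subgroup ?P (add_monoid (mpoly_ring E))"
    proof (rule add.subgroupI)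
      show "?P \<subseteq> carrier (mpoly_ring E)"
        by (auto simp: variable_ideal_def)
      show "?P \<noteq> {}"
        using zero_closed by (auto simp: variable_ideal_def mpoly_ring_simps intro!: exI[of _ 0])
      show "\<ominus>\<^bsub>mpoly_ring E\<^esub> p \<in> ?P" if "p \<in> ?P" for p
        using that a_inv_closed[of p] by (simp add: variable_ideal_def mpoly_ring_a_inv keys_uminus_mpoly)
      show "p \<oplus>\<^bsub>mpoly_ring E\<^esub> q \<in> ?P" if "p \<in> ?P" "q \<in> ?P" for p q
        using that a_closed[of p q] Poly_Mapping.keys_add[of p q] by (auto simp: variable_ideal_def mpoly_ring_simps)
    qed
  qed (use mult in \<open>auto simp: mpoly_ring_simps mult.commute\<close>)
qed

text \<open>If neither factor is in the ideal, both have monomials avoiding \<open>T\<close>. Among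
  these, \<open>unique_sum\<close> selects two whose product does not cancel, and that product
  avoids \<open>T\<close> as well.\<close>

lemma primeideal_variable_ideal:
  "primeideal (variable_ideal E T :: ('e, 'k::field) mpoly set) (mpoly_ring E)"
proof (rule primeidealI[OF ideal_variable_ideal mpoly_ring_cring])
  let ?P = "variable_ideal E T :: ('e, 'k) mpoly set"
  have "1 \<in> carrier (mpoly_ring E)" "1 \<notin> ?P"
    by (auto simp: mpoly_ring_carrier_iff variable_ideal_def)
  then show "carrier (mpoly_ring E) \<noteq> ?P"
    by blast
  fix p q :: "('e, 'k) mpoly"
  assume p: "p \<in> carrier (mpoly_ring E)" and q: "q \<in> carrier (mpoly_ring E)"
    and pq: "p \<otimes>\<^bsub>mpoly_ring E\<^esub> q \<in> ?P"
  show "p \<in> ?P \<or> q \<in> ?P"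
  proof (rule ccontr)
    assume notin: "\<not> (p \<in> ?P \<or> q \<in> ?P)"
    define A where "A = {m \<in> Poly_Mapping.keys p. Poly_Mapping.keys m \<inter> T = {}}"
    define B where "B = {m \<in> Poly_Mapping.keys q. Poly_Mapping.keys m \<inter> T = {}}"
    have "A \<noteq> {}" "B \<noteq> {}"
      using notin p q by (auto simp: A_def B_def variable_ideal_def)
    moreover have "finite A" "finite B"
      by (auto simp: A_def B_def)
    ultimately obtain a b where ab: "a \<in> A" "b \<in> B"
        "\<And>a' b'. a' \<in> A \<Longrightarrow> b' \<in> B \<Longrightarrow> a' + b' = a + b \<Longrightarrow> a' = a \<and> b' = b"
      using unique_sum[of A B] by metis
    define p' where "p' = p - Poly_Mapping.single a (Poly_Mapping.lookup p a)"
    define q' where "q' = q - Poly_Mapping.single b (Poly_Mapping.lookup q b)"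
    have kp: "Poly_Mapping.keys p' = Poly_Mapping.keys p - {a}" "Poly_Mapping.keys q' = Poly_Mapping.keys q - {b}"
      by (auto simp: p'_def q'_def in_keys_iff lookup_minus lookup_single when_def split: if_splits)
    \<comment> \<open>Only the first summand reaches the exponent \<open>a + b\<close>. In the
      second, cancelling \<open>a\<close> would leave \<open>b\<close>, which \<open>q'\<close>
      lacks. In the third, both parts of a decomposition of \<open>a + b\<close> avoid
      \<open>T\<close>, so uniqueness would give \<open>a\<close>, which \<open>p'\<close>
      lacks.\<close>
    have "p * q = Poly_Mapping.single (a + b) (Poly_Mapping.lookup p a * Poly_Mapping.lookup q b)
        + Poly_Mapping.single a (Poly_Mapping.lookup p a) * q' + p' * q"
      by (simp add: p'_def q'_def algebra_simps mult_single)
    moreover have "Poly_Mapping.lookup (Poly_Mapping.single a (Poly_Mapping.lookup p a) * q') (a + b) = 0"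
    proof (rule ccontr)
      assume "\<not> ?thesis"
      then have "a + b \<in> Poly_Mapping.keys (Poly_Mapping.single a (Poly_Mapping.lookup p a) * q')"
        by (simp add: in_keys_iff)
      then obtain c d where "a + b = c + d" "c \<in> Poly_Mapping.keys (Poly_Mapping.single a (Poly_Mapping.lookup p a))" "d \<in> Poly_Mapping.keys q'"
        using keys_mult by blast
      then show False
        by (auto simp: kp split: if_splits)
    qed
    moreover have "Poly_Mapping.lookup (p' * q) (a + b) = 0"
    proof (rule ccontr)
      assume "\<not> ?thesis"
      then have "a + b \<in> Poly_Mapping.keys (p' * q)"
        by (simp add: in_keys_iff)
      then obtain c d where cd: "a + b = c + d" "c \<in> Poly_Mapping.keys p'" "d \<in> Poly_Mapping.keys q"
        using keys_mult by blast
      have "Poly_Mapping.keys (c + d) \<inter> T = {}"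
        using ab(1,2) by (auto simp: A_def B_def keys_add_nat simp flip: cd(1))
      then have "c \<in> A" "d \<in> B"
        using cd by (auto simp: A_def B_def kp keys_add_nat)
      then show False
        using ab(3)[of c d] cd by (auto simp: kp)
    qed
    ultimately have "Poly_Mapping.lookup (p * q) (a + b) = Poly_Mapping.lookup p a * Poly_Mapping.lookup q b"
      by (simp add: lookup_add)
    then have "a + b \<in> Poly_Mapping.keys (p * q)"
      using ab(1,2) by (auto simp: A_def B_def in_keys_iff)
    then have "Poly_Mapping.keys (a + b) \<inter> T \<noteq> {}"
      using pq by (auto simp: variable_ideal_def mpoly_ring_simps)
    then show False
      using ab(1,2) by (auto simp: A_def B_def keys_add_nat)
  qed
qed

text \<open>Each further factor from the ideal adds at least one to the degree in the variables of
  \<open>T\<close>, and addition creates no new monomials.\<close>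

lemma variable_ideal_power_degree:
  fixes p :: "('e, 'k::field) mpoly"
  assumes "finite T" and "p \<in> ideal_power (mpoly_ring E) (variable_ideal E T) s" and "m \<in> Poly_Mapping.keys p"
  shows "s \<le> (\<Sum>e\<in>T. Poly_Mapping.lookup m e)"
  using assms(2,3)
proof (induction s arbitrary: p m)
  case (Suc s)
  from Suc.prems(1) have "\<forall>m\<in>Poly_Mapping.keys p. Suc s \<le> (\<Sum>e\<in>T. Poly_Mapping.lookup m e)"
    unfolding ideal_power_Suc
  proof (induction p rule: ideal_prod.induct)
    case (prod p q)
    show ?case
    proof
      fix m assume "m \<in> Poly_Mapping.keys (p \<otimes>\<^bsub>mpoly_ring E\<^esub> q)"
      then obtain c d where cd: "m = c + d" "c \<in> Poly_Mapping.keys p" "d \<in> Poly_Mapping.keys q"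
        using keys_mult[of p q] by (auto simp: mpoly_ring_simps)
      have "s \<le> (\<Sum>e\<in>T. Poly_Mapping.lookup c e)"
        using Suc.IH prod cd by blast
      moreover have "1 \<le> (\<Sum>e\<in>T. Poly_Mapping.lookup d e)"
      proof -
        have "Poly_Mapping.keys d \<inter> T \<noteq> {}"
          using prod cd by (auto simp: variable_ideal_def)
        then obtain e where "e \<in> T" "0 < Poly_Mapping.lookup d e"
          by (auto simp: in_keys_iff)
        then show ?thesis
          using member_le_sum[of e T "Poly_Mapping.lookup d"] assms(1) by simp
      qed
      ultimately show "Suc s \<le> (\<Sum>e\<in>T. Poly_Mapping.lookup m e)"
        by (simp add: cd lookup_add sum.distrib)
    qed
  next
    case (sum p q)
    then show ?case
      using Poly_Mapping.keys_add[of p q] by (auto simp: mpoly_ring_simps)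
  qed
  with Suc.prems(2) show ?case by blast
qed simp

lemma mpoly_var_mem_prime:
  assumes "primeideal Q (mpoly_ring E :: ('e, 'k::field) mpoly ring)"
    and "finite U" "U \<subseteq> E" "sqfree_monom U \<in> Q"
  shows "\<exists>e\<in>U. mpoly_var e \<in> Q"
  using assms(2-4)
proof (induction U rule: finite_induct)
  interpret primeideal Q "mpoly_ring E :: ('e, 'k) mpoly ring"
    by fact
  {
    case empty
    then have "\<one>\<^bsub>mpoly_ring E\<^esub> \<in> Q"
      by (simp add: sqfree_monom_def mpoly_ring_simps)
    then show ?case
      using one_imp_carrier I_notcarr by blast
  next
    case (insert e U)
    then have "(mpoly_var e :: ('e, 'k) mpoly) \<in> carrier (mpoly_ring E)"
      by (auto simp: mpoly_ring_carrier_iff mpoly_var_def)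
    with insert show ?case
      using I_prime[of "mpoly_var e" "sqfree_monom U"] sqfree_monom_closed[of U E]
      by (auto simp: sqfree_monom_def mpoly_ring_simps)
  }
qed

text \<open>For \<open>e \<in> T\<close>, \<open>min\<close> gives a \<open>B\<close> meeting
  \<open>T\<close> in \<open>e\<close> only. A prime \<open>Q\<close> below the variable ideal that
  contains the generator of \<open>B\<close> contains a variable from \<open>B\<close>; this
  variable also lies in \<open>T\<close>, so it is that of \<open>e\<close>.\<close>

lemma variable_ideal_minimal_prime:
  assumes "finite E" and F: "\<And>B. B \<in> F \<Longrightarrow> B \<subseteq> E" and "T \<subseteq> E"
    and hit: "\<And>B. B \<in> F \<Longrightarrow> T \<inter> B \<noteq> {}"
    and min: "\<And>e. e \<in> T \<Longrightarrow> \<exists>B\<in>F. (T - {e}) \<inter> B = {}"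
  shows "(variable_ideal E T :: ('e, 'k::field) mpoly set)
    \<in> minimal_primes (mpoly_ring E) (genideal (mpoly_ring E) (sqfree_monom ` F))"
proof -
  let ?R = "mpoly_ring E :: ('e, 'k) mpoly ring"
  let ?P = "variable_ideal E T :: ('e, 'k) mpoly set"
  interpret cring ?R
    by (rule mpoly_ring_cring)
  have finF: "finite B" if "B \<in> F" for B
    using F[OF that] assms(1) by (rule finite_subset)
  have "sqfree_monom ` F \<subseteq> ?P"
  proof
    fix p :: "('e, 'k) mpoly" assume "p \<in> sqfree_monom ` F"
    then obtain B where B: "B \<in> F" "p = sqfree_monom B"
      by blast
    then have "Poly_Mapping.keys p = {sqfree_exponent B}"
      by (simp add: finF sqfree_monom_eq_single)
    then show "p \<in> ?P"
      using hit[of B] F[of B] B by (auto simp: variable_ideal_def mpoly_ring_carrier_iff keys_sqfree_exponent finF)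
  qed
  then have sub: "genideal ?R (sqfree_monom ` F) \<subseteq> ?P"
    by (rule genideal_minimal[OF ideal_variable_ideal])
  have "Q = ?P" if Q: "primeideal Q ?R" "genideal ?R (sqfree_monom ` F) \<subseteq> Q" "Q \<subseteq> ?P" for Q
  proof
    interpret Q: primeideal Q ?R
      by fact
    have gens: "sqfree_monom B \<in> Q" if "B \<in> F" for B
    proof -
      have "sqfree_monom ` F \<subseteq> genideal ?R (sqfree_monom ` F)"
        using F by (intro genideal_self) (auto intro: sqfree_monom_closed)
      then show ?thesis
        using that Q(2) by blast
    qed
    have var: "mpoly_var e \<in> Q" if e: "e \<in> T" for e
    proof -
      obtain B where B: "B \<in> F" "(T - {e}) \<inter> B = {}"
        using min[OF e] by blast
      obtain x where x: "x \<in> B" "mpoly_var x \<in> Q"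
        using mpoly_var_mem_prime[OF Q(1) finF[OF B(1)] F[OF B(1)] gens[OF B(1)]] by blast
      then have "(mpoly_var x :: ('e, 'k) mpoly) \<in> ?P"
        using Q(3) by blast
      then have "x \<in> T"
        by (simp add: variable_ideal_def mpoly_var_def)
      with x B show ?thesis by blast
    qed
    show "?P \<subseteq> Q"
    proof
      fix p assume p: "p \<in> ?P"
      show "p \<in> Q"
      proof (rule ideal_memI_monomials)
        fix m assume m: "m \<in> Poly_Mapping.keys p"
        then obtain e where e: "e \<in> Poly_Mapping.keys m" "e \<in> T"
          using p by (auto simp: variable_ideal_def)
        define m' where "m' = m - Poly_Mapping.single e 1"
        have mm': "m = Poly_Mapping.single e 1 + m'"
          using e(1) by (intro poly_mapping_eqI)
            (auto simp: m'_def lookup_add lookup_minus lookup_single when_def in_keys_iff)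
        have "Poly_Mapping.keys m \<subseteq> E"
          using p m by (auto simp: variable_ideal_def mpoly_ring_carrier_iff)
        then have "Poly_Mapping.single m' (Poly_Mapping.lookup p m) \<in> carrier ?R"
          by (auto simp: mpoly_ring_carrier_iff mm' keys_add_nat)
        then have "mpoly_var e * Poly_Mapping.single m' (Poly_Mapping.lookup p m) \<in> Q"
          using Q.I_r_closed[OF var[OF e(2)]] by (simp add: mpoly_ring_simps)
        moreover have "mpoly_var e * Poly_Mapping.single m' c = Poly_Mapping.single m c" for c :: 'k
          by (subst mm') (simp add: mpoly_var_def mult_single)
        ultimately show "Poly_Mapping.single m (Poly_Mapping.lookup p m) \<in> Q"
          by simp
      qed (rule Q.ideal_axioms)
    qed
  qed (use Q in blast)
  then show ?thesis
    using primeideal_variable_ideal sub by (auto simp: minimal_primes_def)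
qed

text \<open>An inclusion-minimal subset of \<open>T\<close> that still meets all of \<open>F\<close>
  gives a minimal prime, and enlarging it back to \<open>T\<close> only increases the
  degree.\<close>

lemma symbolic_power_degree:
  fixes p :: "('e, 'k::field) mpoly"
  assumes "finite E" and F: "\<And>B. B \<in> F \<Longrightarrow> B \<subseteq> E" and T: "T \<subseteq> E" "\<And>B. B \<in> F \<Longrightarrow> T \<inter> B \<noteq> {}"
    and p: "p \<in> symbolic_power (mpoly_ring E) (genideal (mpoly_ring E) (sqfree_monom ` F)) s"
    and m: "m \<in> Poly_Mapping.keys p"
  shows "s \<le> (\<Sum>e\<in>T. Poly_Mapping.lookup m e)"
proof -
  have finT: "finite T"
    using T(1) assms(1) by (rule finite_subset)
  define \<T> where "\<T> = {T' \<in> Pow T. \<forall>B\<in>F. T' \<inter> B \<noteq> {}}"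
  have "finite \<T>" "T \<in> \<T>"
    using finT T by (auto simp: \<T>_def)
  then obtain T' where T': "T' \<in> \<T>" "\<forall>X\<in>\<T>. X \<subseteq> T' \<longrightarrow> T' = X"
    using finite_has_minimal2[of \<T> T] by blast
  have "\<exists>B\<in>F. (T' - {e}) \<inter> B = {}" if "e \<in> T'" for e
  proof (rule ccontr)
    assume "\<not> ?thesis"
    then have "T' - {e} \<in> \<T>"
      using T'(1) by (auto simp: \<T>_def)
    with T'(2) that show False by blast
  qed
  then have "(variable_ideal E T' :: ('e, 'k) mpoly set)
      \<in> minimal_primes (mpoly_ring E) (genideal (mpoly_ring E) (sqfree_monom ` F))"
    using T' T(1) by (intro variable_ideal_minimal_prime[OF assms(1) F]) (auto simp: \<T>_def)
  then have "p \<in> ideal_power (mpoly_ring E) (variable_ideal E T') s"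
    using p by (auto simp: symbolic_power_def)
  then have "s \<le> (\<Sum>e\<in>T'. Poly_Mapping.lookup m e)"
    using m T' finT by (intro variable_ideal_power_degree) (auto simp: \<T>_def intro: finite_subset)
  also have "\<dots> \<le> (\<Sum>e\<in>T. Poly_Mapping.lookup m e)"
    using T' finT by (intro sum_mono2) (auto simp: \<T>_def)
  finally show ?thesis .
qed

text \<open>Induction on \<open>r\<close>: split off one generator of positive multiplicity and
  lower that multiplicity by one.\<close>

lemma monomial_mem_ideal_power:
  fixes c :: "'k::field" and f :: "'e set \<Rightarrow> nat"
  assumes "finite E" and F: "\<And>B. B \<in> F \<Longrightarrow> B \<subseteq> E" and "finite F"
    and "Poly_Mapping.keys m \<subseteq> E" and "r \<le> sum f F" and "\<And>e. e \<in> E \<Longrightarrow> sum f {B \<in> F. e \<in> B} \<le> Poly_Mapping.lookup m e"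
  shows "Poly_Mapping.single m c
    \<in> ideal_power (mpoly_ring E) (genideal (mpoly_ring E) (sqfree_monom ` F)) r"
  using assms(4-6)
proof (induction r arbitrary: f m)
  case 0
  then show ?case
    by (simp add: ideal_power_0 mpoly_ring_carrier_iff)
next
  case (Suc r)
  interpret cring "mpoly_ring E :: ('e, 'k) mpoly ring"
    by (rule mpoly_ring_cring)
  have "sum f F \<noteq> 0"
    using Suc.prems(2) by simp
  then obtain B where B: "B \<in> F" "0 < f B"
    using assms(3) by (metis gr0I sum.neutral)
  have finB: "finite B"
    using F[OF B(1)] assms(1) by (rule finite_subset)
  define g where "g = f(B := f B - 1)"
  define m' where "m' = m - sqfree_exponent B"
  have sumg: "sum f G = sum g G + of_bool (B \<in> G)" if "finite G" for G
  proof -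
    have "sum f (G - {B}) = sum g (G - {B})"
      by (intro sum.cong) (auto simp: g_def)
    then show ?thesis
      using B(2) that by (cases "B \<in> G") (auto simp: g_def sum.remove[of G B])
  qed
  have fe: "sum g {B \<in> F. e \<in> B} + of_bool (e \<in> B) \<le> Poly_Mapping.lookup m e" if "e \<in> E" for e
    using sumg[of "{B \<in> F. e \<in> B}"] Suc.prems(3)[OF that] B(1) assms(3) by simp
  \<comment> \<open>This makes the truncated subtraction in \<open>m'\<close> exact.\<close>
  have le: "of_bool (e \<in> B) \<le> Poly_Mapping.lookup m e" for e
    using fe[of e] F[OF B(1)] by (cases "e \<in> B") (auto simp: Suc_le_eq)
  have m: "m = m' + sqfree_exponent B"
    using le by (intro poly_mapping_eqI)
      (simp add: m'_def lookup_add lookup_minus lookup_sqfree_exponent finB)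
  have "Poly_Mapping.single m' c
      \<in> ideal_power (mpoly_ring E) (genideal (mpoly_ring E) (sqfree_monom ` F)) r"
  proof (rule Suc.IH)
    show "Poly_Mapping.keys m' \<subseteq> E"
      using Suc.prems(1) by (simp add: m keys_add_nat)
    show "r \<le> sum g F"
      using sumg[OF assms(3)] B(1) Suc.prems(2) by simp
    show "sum g {B \<in> F. e \<in> B} \<le> Poly_Mapping.lookup m' e" if "e \<in> E" for e
      using fe[OF that] by (simp add: m lookup_add lookup_sqfree_exponent finB)
  qed
  moreover have "sqfree_monom B \<in> genideal (mpoly_ring E :: ('e, 'k) mpoly ring) (sqfree_monom ` F)"
  proof -
    have "sqfree_monom ` F \<subseteq> genideal (mpoly_ring E :: ('e, 'k) mpoly ring) (sqfree_monom ` F)"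
      using F by (intro genideal_self) (auto intro: sqfree_monom_closed)
    with B(1) show ?thesis by blast
  qed
  ultimately have "Poly_Mapping.single m' c \<otimes>\<^bsub>mpoly_ring E\<^esub> sqfree_monom B
      \<in> ideal_power (mpoly_ring E) (genideal (mpoly_ring E) (sqfree_monom ` F)) (Suc r)"
    unfolding ideal_power_Suc by (rule ideal_prod.prod)
  then show ?case
    by (simp add: mpoly_ring_simps sqfree_monom_eq_single finB mult_single flip: m)
qed

text \<open>Applied to each exponent of a polynomial in the symbolic power, \<open>bound\<close>
  verifies the hypothesis of \<open>integer_packing\<close>: for \<open>s > \<rho> * r\<close> the
  surplus grows linearly in \<open>t\<close> and eventually exceeds the rounding loss
  \<open>\<rho> * card F\<close>. Real \<open>a\<close> and \<open>S\<close> allow rescaling and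
  exchanging the roles of \<open>a\<close> and \<open>w\<close>.\<close>

lemma asymptotic_resurgence_le:
  fixes \<rho> :: real
  assumes "finite E" and F: "\<And>B. B \<in> F \<Longrightarrow> B \<subseteq> E" and "0 < \<rho>"
    and bound: "\<And>a w S. 0 \<le> S \<Longrightarrow> (\<And>e. e \<in> E \<Longrightarrow> 0 \<le> a e) \<Longrightarrow> (\<And>e. e \<in> E \<Longrightarrow> 0 \<le> w e) \<Longrightarrow>
      (\<And>T. T \<subseteq> E \<Longrightarrow> (\<And>B. B \<in> F \<Longrightarrow> T \<inter> B \<noteq> {}) \<Longrightarrow> S \<le> sum a T) \<Longrightarrow>
      (\<And>B. B \<in> F \<Longrightarrow> 1 \<le> sum w B) \<Longrightarrow> S \<le> \<rho> * (\<Sum>e\<in>E. a e * w e)"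
  shows "asymptotic_resurgence (mpoly_ring E)
    (genideal (mpoly_ring E) (sqfree_monom ` F) :: ('e, 'k::field) mpoly set) \<le> ereal \<rho>"
proof -
  let ?R = "mpoly_ring E :: ('e, 'k) mpoly ring"
  let ?I = "genideal ?R (sqfree_monom ` F)"
  interpret cring ?R
    by (rule mpoly_ring_cring)
  have finF: "finite F"
    using F assms(1) by (intro finite_subset[of F "Pow E"]) auto
  have "ideal ?I ?R"
    using F by (intro genideal_ideal) (auto intro: sqfree_monom_closed)
  then have idl: "ideal (ideal_power ?R ?I r) ?R" for r
    by (rule ideal_ideal_power)
  have "real s / real r \<le> \<rho>" if r: "0 < r"
    and ev: "\<forall>\<^sub>F t in sequentially. \<not> symbolic_power ?R ?I (s * t) \<subseteq> ideal_power ?R ?I (r * t)" for s r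
  proof (rule ccontr)
    assume "\<not> ?thesis"
    then have gap: "0 < real s - \<rho> * real r"
      using r by (simp add: field_simps)
    obtain N where N: "\<rho> * real (card F) / (real s - \<rho> * real r) \<le> real N"
      using real_arch_simple by blast
    have "symbolic_power ?R ?I (s * t) \<subseteq> ideal_power ?R ?I (r * t)" if t: "N \<le> t" for t
    proof
      fix p assume p: "p \<in> symbolic_power ?R ?I (s * t)"
      have "\<rho> * real (card F) / (real s - \<rho> * real r) \<le> real t"
        using N t by linarith
      then have st: "\<rho> * real (r * t + card F) \<le> real (s * t)"
        using gap by (simp add: field_simps)
      show "p \<in> ideal_power ?R ?I (r * t)"
      proof (rule ideal_memI_monomials[OF idl])
        fix m assume m: "m \<in> Poly_Mapping.keys p"
        have "\<exists>f :: 'e set \<Rightarrow> nat. r * t \<le> sum f F \<and> (\<forall>e\<in>E. sum f {B \<in> F. e \<in> B} \<le> Poly_Mapping.lookup m e)"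
        proof (rule integer_packing[OF assms(1) finF F])
          fix w :: "'e \<Rightarrow> real"
          assume w: "\<And>e. e \<in> E \<Longrightarrow> 0 \<le> w e" "\<And>B. B \<in> F \<Longrightarrow> 1 \<le> sum w B"
          have "real (s * t) \<le> \<rho> * (\<Sum>e\<in>E. real (Poly_Mapping.lookup m e) * w e)"
          proof (rule bound)
            fix T assume "T \<subseteq> E" "\<And>B. B \<in> F \<Longrightarrow> T \<inter> B \<noteq> {}"
            then have "s * t \<le> (\<Sum>e\<in>T. Poly_Mapping.lookup m e)"
              using symbolic_power_degree[OF assms(1) F _ _ p m] by blast
            then show "real (s * t) \<le> (\<Sum>e\<in>T. real (Poly_Mapping.lookup m e))"
              by (metis of_nat_le_iff of_nat_sum)
          qed (use w in auto)
          with st have "\<rho> * real (r * t + card F) \<le> \<rho> * (\<Sum>e\<in>E. real (Poly_Mapping.lookup m e) * w e)"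
            by linarith
          then show "real (r * t + card F) \<le> (\<Sum>e\<in>E. real (Poly_Mapping.lookup m e) * w e)"
            using assms(3) by simp
        qed
        moreover have "Poly_Mapping.keys m \<subseteq> E"
          using p m by (auto simp: symbolic_power_def mpoly_ring_carrier_iff)
        ultimately show "Poly_Mapping.single m (Poly_Mapping.lookup p m) \<in> ideal_power ?R ?I (r * t)"
          using monomial_mem_ideal_power[OF assms(1) F finF] by blast
      qed
    qed
    then have "\<forall>\<^sub>F t in sequentially. symbolic_power ?R ?I (s * t) \<subseteq> ideal_power ?R ?I (r * t)"
      by (auto simp: eventually_sequentially)
    with ev have "\<forall>\<^sub>F t in sequentially. False"
      by eventually_elim simp
    then show False
      by simp
  qed
  then show ?thesis
    unfolding asymptotic_resurgence_def by (intro Sup_least) auto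
qed

section \<open>Weights on a matroid\<close>

text \<open>A nonnegative \<open>w\<close> is a nonnegative combination of indicators of its level
  sets. The induction subtracts the least positive value, which shrinks the support and only shifts
  the levels.\<close>

lemma sum_mult_nonneg_layers:
  fixes w f :: "'e \<Rightarrow> real"
  assumes "finite E" and "\<And>e. e \<in> E \<Longrightarrow> 0 \<le> w e"
    and "\<And>t. 0 \<le> t \<Longrightarrow> 0 \<le> sum f {e \<in> E. t < w e}"
  shows "0 \<le> (\<Sum>e\<in>E. w e * f e)"
  using assms(2,3)
proof (induction "card {e \<in> E. 0 < w e}" arbitrary: w rule: less_induct)
  case less
  define P where "P = {e \<in> E. 0 < w e}"
  have fin: "finite P"
    using assms(1) by (simp add: P_def)
  show ?case
  proof (cases "P = {}")
    case True
    then have "w e = 0" if "e \<in> E" for e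
      using less.prems(1)[OF that] that unfolding P_def by force
    then show ?thesis by simp
  next
    case False
    define v where "v = Min (w ` P)"
    have "v \<in> w ` P"
      using fin False by (simp add: v_def)
    then obtain p where p: "p \<in> P" "w p = v"
      by auto
    have v: "0 < v" "\<And>e. e \<in> P \<Longrightarrow> v \<le> w e"
      using p fin by (auto simp: P_def v_def)
    define u where "u e = (if e \<in> P then w e - v else 0)" for e
    have levels: "{e \<in> E. t < u e} = {e \<in> E. t + v < w e}" if "0 \<le> t" for t
      using that v by (auto simp: u_def P_def split: if_splits)
    have "0 \<le> (\<Sum>e\<in>E. u e * f e)"
    proof (rule less.hyps)
      have "{e \<in> E. 0 < u e} \<subset> P"
        using p v by (auto simp: u_def P_def split: if_splits)
      then show "card {e \<in> E. 0 < u e} < card {e \<in> E. 0 < w e}"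
        using fin by (simp add: psubset_card_mono flip: P_def)
      show "0 \<le> u e" if "e \<in> E" for e
        using v by (simp add: u_def)
      show "0 \<le> sum f {e \<in> E. t < u e}" if "0 \<le> t" for t
        using less.prems(2)[of "t + v"] that v by (simp add: levels)
    qed
    moreover have "(\<Sum>e\<in>E. w e * f e) = (\<Sum>e\<in>E. u e * f e) + v * sum f P"
    proof -
      have "w e = u e + (if e \<in> P then v else 0)" if "e \<in> E" for e
        using less.prems(1)[OF that] that by (auto simp: u_def P_def)
      then have "(\<Sum>e\<in>E. w e * f e) = (\<Sum>e\<in>E. u e * f e) + (\<Sum>e\<in>E. if e \<in> P then v * f e else 0)"
        by (auto simp: algebra_simps if_distrib simp flip: sum.distrib intro!: sum.cong)
      also have "(\<Sum>e\<in>E. if e \<in> P then v * f e else 0) = v * sum f P"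
        unfolding sum_distrib_left P_def using assms(1) by (simp add: sum.inter_filter)
      finally show ?thesis .
    qed
    moreover have "0 \<le> sum f P"
      using less.prems(2)[of 0] by (simp add: P_def)
    ultimately show ?thesis
      using v(1) by simp
  qed
qed

text \<open>Discarding a lightest element never lowers the average; repeat until \<open>j\<close>
  elements remain.\<close>

lemma heavy_subset:
  fixes a :: "'e \<Rightarrow> real"
  assumes "finite A" and "j \<le> card A"
  shows "\<exists>J\<subseteq>A. card J = j \<and> real j * sum a A \<le> real (card A) * sum a J"
  using assms
proof (induction "card A" arbitrary: A rule: less_induct)
  case less
  show ?case
  proof (cases "j = card A")
    case True
    then show ?thesis by auto
  next
    case False
    then have "A \<noteq> {}"
      using less.prems by auto
    define v where "v = Min (a ` A)"
    have "v \<in> a ` A"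
      using less.prems(1) \<open>A \<noteq> {}\<close> by (simp add: v_def)
    then obtain e where e: "e \<in> A" "a e = v"
      by auto
    have v: "v \<le> a x" if "x \<in> A" for x
      using less.prems(1) that by (simp add: v_def)
    have card: "card A = Suc (card (A - {e}))"
      using e(1) less.prems(1) by (metis card_Suc_Diff1)
    obtain J where J: "J \<subseteq> A - {e}" "card J = j"
        "real j * sum a (A - {e}) \<le> real (card (A - {e})) * sum a J"
      using less.hyps[of "A - {e}"] less.prems False card by auto
    have "real j * v \<le> sum a J"
      using J v by (metis DiffE of_nat_mult subsetD sum_bounded_below)
    moreover have "sum a A = v + sum a (A - {e})"
      using e less.prems(1) by (simp add: sum.remove)
    ultimately have "real j * sum a A \<le> real (card A) * sum a J"
      using J(3) card by (simp add: algebra_simps)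
    with J show ?thesis by blast
  qed
qed

text \<open>Cross-multiplied monotonicity of \<open>r * (c + 1) / (r + c)\<close>, the ratio that
  constant weights give on the uniform matroid of rank \<open>r\<close> and corank
  \<open>c\<close>.\<close>

lemma uniform_ratio_mono:
  fixes r c r' c' :: real
  assumes "1 \<le> r" "r \<le> r'" "0 \<le> c" "c \<le> c'"
  shows "r * (c + 1) * (r' + c') \<le> r' * (c' + 1) * (r + c)"
proof -
  define x y where "x = r' - r" and "y = c' - c"
  have "r' * (c' + 1) * (r + c) - r * (c + 1) * (r' + c')
      = r * y * (r - 1) + x * ((c + 1) * c + y * (r + c))"
    by (simp add: x_def y_def algebra_simps)
  also have "\<dots> \<ge> 0"
    using assms by (auto simp: x_def y_def)
  finally show ?thesis
    by simp
qed

section \<open>Bases and their exchange properties\<close>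

context matroid
begin

lemma finite_indep: "indep X \<Longrightarrow> finite X"
  using indep_subset_ground finite_ground finite_subset by blast

lemma bases_iff: "B \<in> matroid_bases indep \<longleftrightarrow> indep B \<and> card B = matroid_rank indep"
  by (simp add: bases_eq)

lemma basis_subset_ground: "B \<in> matroid_bases indep \<Longrightarrow> B \<subseteq> E"
  by (simp add: bases_iff indep_subset_ground)

lemma finite_indep_sets: "finite {X. indep X}"
  by (rule finite_subset[of _ "Pow E"]) (use indep_subset_ground finite_ground in auto)

lemma finite_bases: "finite (matroid_bases indep)"
  by (rule finite_subset[OF _ finite_indep_sets]) (auto simp: bases_iff)

lemma card_indep_le: "indep X \<Longrightarrow> card X \<le> matroid_rank indep"
  unfolding matroid_rank_def using finite_indep_sets by (intro Max_ge) auto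

lemma obtain_basis:
  obtains B where "B \<in> matroid_bases indep"
proof -
  have "matroid_rank indep \<in> card ` {X. indep X}"
    unfolding matroid_rank_def using finite_indep_sets indep_empty by (intro Max_in) auto
  then show ?thesis
    using that by (auto simp: bases_iff)
qed

lemma indep_extend:
  assumes "indep X" "indep Y" "card X \<le> card Y"
  shows "\<exists>Z. indep Z \<and> X \<subseteq> Z \<and> Z \<subseteq> X \<union> Y \<and> card Z = card Y"
  using assms
proof (induction "card Y - card X" arbitrary: X)
  case 0
  then show ?case by auto
next
  case (Suc d)
  then have "card X < card Y"
    by linarith
  then obtain y where y: "y \<in> Y - X" "indep (insert y X)"
    using indep_augment[of X Y] Suc.prems by auto
  moreover have "card (insert y X) = Suc (card X)"
    using y finite_indep[OF Suc.prems(1)] by simp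
  ultimately have "d = card Y - card (insert y X)" "card (insert y X) \<le> card Y"
    using Suc.hyps(2) by linarith+
  then obtain Z where "indep Z" "insert y X \<subseteq> Z" "Z \<subseteq> insert y X \<union> Y" "card Z = card Y"
    using Suc.hyps(1) y(2) Suc.prems(2) by blast
  with y show ?case by blast
qed

text \<open>A basis of least total weight has full rank in every sublevel set, as in the greedy
  algorithm: otherwise its light part could be augmented by a light \<open>y\<close>, and completing
  the result from \<open>B\<close> would trade a heavy element for \<open>y\<close>.\<close>

lemma min_weight_basis:
  fixes w :: "'e \<Rightarrow> real"
  shows "\<exists>B\<in>matroid_bases indep. \<forall>t X. indep X \<and> X \<subseteq> {e. w e \<le> t} \<longrightarrow> card X \<le> card (B \<inter> {e. w e \<le> t})"
proof -
  have ne: "matroid_bases indep \<noteq> {}"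
    using obtain_basis by blast
  have "Min (sum w ` matroid_bases indep) \<in> sum w ` matroid_bases indep"
    using finite_bases ne by simp
  then obtain B where B: "B \<in> matroid_bases indep" "sum w B = Min (sum w ` matroid_bases indep)"
    by auto
  have min: "sum w B \<le> sum w Z" if "Z \<in> matroid_bases indep" for Z
    using B(2) finite_bases that by simp
  have "card X \<le> card (B \<inter> {e. w e \<le> t})" if X: "indep X" "X \<subseteq> {e. w e \<le> t}" for X t
  proof (rule ccontr)
    assume "\<not> ?thesis"
    moreover have indB: "indep B" "card B = matroid_rank indep"
      using B by (auto simp: bases_iff)
    ultimately obtain y where y: "y \<in> X - B \<inter> {e. w e \<le> t}" "indep (insert y (B \<inter> {e. w e \<le> t}))"
      using indep_augment[of "B \<inter> {e. w e \<le> t}" X] X indep_subset[of B] by auto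
    then have yB: "w y \<le> t" "y \<notin> B"
      using X by auto
    obtain Z where Z: "indep Z" "insert y (B \<inter> {e. w e \<le> t}) \<subseteq> Z"
        "Z \<subseteq> insert y (B \<inter> {e. w e \<le> t}) \<union> B" "card Z = card B"
      using indep_extend[OF y(2) indB(1)] card_indep_le[OF y(2)] indB(2) by auto
    have fin: "finite B"
      using finite_indep indB by blast
    have "\<not> insert y B \<subseteq> Z"
      using Z(4) yB(2) fin finite_indep[OF Z(1)] card_mono[of Z "insert y B"] by auto
    then obtain x where x: "x \<in> insert y B" "x \<notin> Z"
      by blast
    then have xB: "x \<in> B" "t < w x"
      using Z(2) by auto
    \<comment> \<open>\<open>Z\<close> lies in \<open>insert y B\<close>, misses \<open>x\<close>,
      and has the size of \<open>B\<close>, so nothing else is missing.\<close>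
    have "Z = insert y B - {x}"
    proof (rule card_subset_eq)
      show "card Z = card (insert y B - {x})"
        using Z(4) xB(1) yB(2) fin by (simp add: card_Diff_singleton)
    qed (use Z x fin in auto)
    moreover have "sum w (insert y B - {x}) = sum w B + w y - w x"
      using xB(1) yB(2) fin by (simp add: sum_diff1)
    ultimately have "sum w Z < sum w B"
      using xB(2) yB(1) by simp
    moreover have "Z \<in> matroid_bases indep"
      using Z indB by (simp add: bases_iff)
    ultimately show False
      using min[of Z] by simp
  qed
  with B(1) show ?thesis by blast
qed

text \<open>In rank 0 or full rank only one set has the right size, and it is a basis.\<close>

lemma nonbasis_rank_bounds:
  assumes H: "H \<subseteq> E" "card H = matroid_rank indep" "H \<notin> matroid_bases indep"
  shows "0 < matroid_rank indep" and "matroid_rank indep < card E"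
proof -
  show "0 < matroid_rank indep"
  proof (rule ccontr)
    assume "\<not> ?thesis"
    then have "H = {}"
      using H finite_subset[OF H(1) finite_ground] by auto
    with H indep_empty show False
      by (simp add: bases_iff)
  qed
  show "matroid_rank indep < card E"
  proof (rule ccontr)
    assume "\<not> ?thesis"
    then have full: "X = E" if "X \<subseteq> E" "card X = matroid_rank indep" for X
      using that card_seteq[OF finite_ground, of X] by simp
    obtain B where B: "B \<in> matroid_bases indep"
      by (rule obtain_basis)
    then have "H = B"
      using full[of B] full[of H] H basis_subset_ground[OF B] by (simp add: bases_iff)
    with B H show False by simp
  qed
qed

lemma small_complement_meets_basis:
  assumes "card J < matroid_rank indep" "B \<in> matroid_bases indep" "finite J"
  shows "(E - J) \<inter> B \<noteq> {}"
proof
  assume "(E - J) \<inter> B = {}"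
  then have "B \<subseteq> J"
    using basis_subset_ground[OF assms(2)] by auto
  then show False
    using card_mono[OF assms(3), of B] assms(1,2) by (simp add: bases_iff)
qed

end

text \<open>\<open>H\<close> witnesses non-uniformity; \<open>a\<close> and \<open>S\<close>
  abstract a monomial in a symbolic power. The last two assumptions say that \<rho> is at least
  \<open>r * (c + 1) / (r + c)\<close> for the pairs \<open>(k, n - k - 1)\<close> and
  \<open>(k - 1, n - k)\<close>: corank or rank lowered by one.\<close>

locale nonuniform_weighting = matroid +
  fixes H :: "'e set" and a :: "'e \<Rightarrow> real" and S \<rho> :: real
  assumes H: "H \<subseteq> E" "card H = matroid_rank indep" "H \<notin> matroid_bases indep"
    and a_nonneg: "\<And>e. e \<in> E \<Longrightarrow> 0 \<le> a e"
    and S_nonneg: "0 \<le> S"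
    and meets: "\<And>T. T \<subseteq> E \<Longrightarrow> (\<And>B. B \<in> matroid_bases indep \<Longrightarrow> T \<inter> B \<noteq> {}) \<Longrightarrow> S \<le> sum a T"
    and rho_rank: "real (matroid_rank indep) * (real (card E) - real (matroid_rank indep))
        \<le> \<rho> * (real (card E) - 1)"
    and rho_contract: "(real (matroid_rank indep) - 1) * (real (card E) - real (matroid_rank indep) + 1)
        \<le> \<rho> * (real (card E) - 1)"
begin

abbreviation "k \<equiv> matroid_rank indep"
abbreviation "n \<equiv> card E"

lemma rank_pos: "0 < k" and rank_less: "k < n"
  using nonbasis_rank_bounds[OF H] by simp_all

lemma rho_nonneg: "0 \<le> \<rho>"
proof -
  have "0 \<le> real k * (real n - real k)"
    using rank_less by simp
  also have "\<dots> \<le> \<rho> * (real n - 1)"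
    by (rule rho_rank)
  finally show ?thesis
    using rank_pos rank_less by (simp add: zero_le_mult_iff)
qed

lemma meets_complement: "J \<subseteq> E \<Longrightarrow> card J < k \<Longrightarrow> S \<le> sum a (E - J)"
  using small_complement_meets_basis finite_subset[OF _ finite_ground] by (intro meets) blast+

text \<open>Besides the sets \<open>E - J\<close> with \<open>card J < k\<close>, the complement \<open>D\<close> of the missing basis \<open>H\<close> also meets
  all bases. The estimates come from applying \<open>meets\<close> to \<open>D\<close> and to \<open>E - J\<close>, with the heaviest possible
  \<open>J\<close> inside \<open>D\<close>, or containing \<open>D\<close> if \<open>D\<close> is too small.\<close>

lemma weight_ground: "real k * S \<le> \<rho> * sum a E"
proof -
  define D c where "D = E - H" and "c = n - k"
  have cn: "real c = real n - real k" "0 < c"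
    using rank_less by (auto simp: c_def)
  have fin: "finite H" "finite D"
    using H finite_ground by (auto simp: D_def finite_subset)
  have cardD: "card D = c"
    using H fin by (simp add: D_def c_def card_Diff_subset)
  have sumE: "sum a E = sum a D + sum a H"
    using H finite_ground unfolding D_def by (metis sum.subset_diff)
  have D: "S \<le> sum a D"
  proof (rule meets)
    fix B assume B: "B \<in> matroid_bases indep"
    show "D \<inter> B \<noteq> {}"
    proof
      assume "D \<inter> B = {}"
      then have "B \<subseteq> H"
        using basis_subset_ground[OF B] by (auto simp: D_def)
      then have "B = H"
        using B H fin by (intro card_subset_eq) (auto simp: bases_iff)
      with B H show False by simp
    qed
  qed (auto simp: D_def)
  have aE: "0 \<le> sum a E"
    using a_nonneg by (rule sum_nonneg)
  show ?thesis
  proof (cases "k - 1 \<le> c")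
    case True
    then obtain J where J: "J \<subseteq> D" "card J = k - 1" "real (k - 1) * sum a D \<le> real c * sum a J"
      using heavy_subset[OF fin(2), of "k - 1" a] cardD by auto
    have JE: "J \<subseteq> E"
      using J by (auto simp: D_def)
    have "S \<le> sum a (E - J)"
      using J JE rank_pos by (intro meets_complement) auto
    then have "S + sum a J \<le> sum a E"
      using JE finite_ground by (simp add: sum_diff)
    then have "real c * (S + sum a J) \<le> real c * sum a E"
      by (intro mult_left_mono) auto
    moreover have "real (k - 1) * S \<le> real (k - 1) * sum a D"
      using D by (intro mult_left_mono) auto
    ultimately have "real c * S + real (k - 1) * S \<le> real c * sum a E"
      using J(3) by (simp add: algebra_simps)
    moreover have "real n - 1 = real c + real (k - 1)"
      using rank_pos cn by simp
    ultimately have "(real n - 1) * S \<le> real c * sum a E"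
      by (simp only: distrib_right)
    then have "\<rho> * ((real n - 1) * S) \<le> \<rho> * (real c * sum a E)"
      using rho_nonneg by (rule mult_left_mono)
    moreover have "real k * real c * S \<le> \<rho> * (real n - 1) * S"
      using rho_rank S_nonneg cn(1) by (intro mult_right_mono) simp_all
    ultimately have "real c * (real k * S) \<le> real c * (\<rho> * sum a E)"
      by (simp add: algebra_simps)
    then show ?thesis
      using cn(2) by simp
  next
    case False
    \<comment> \<open>With this size, \<open>D \<union> J\<close> has \<open>k - 1\<close> elements,
      the most that \<open>meets_complement\<close> permits.\<close>
    then obtain J where J: "J \<subseteq> H" "card J = k - 1 - c"
        "real (k - 1 - c) * sum a H \<le> real k * sum a J"
      using heavy_subset[OF fin(1), of "k - 1 - c" a] H(2) by auto
    have JE: "D \<union> J \<subseteq> E"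
      using J H by (auto simp: D_def)
    have "card (D \<union> J) < k"
      using card_Un_le[of D J] J(2) cardD False by linarith
    then have "S \<le> sum a (E - (D \<union> J))"
      using JE by (intro meets_complement)
    also have "E - (D \<union> J) = H - J"
      using H by (auto simp: D_def)
    also have "sum a (H - J) = sum a H - sum a J"
      using J fin by (simp add: sum_diff)
    finally have "real k * (S + sum a J) \<le> real k * sum a H"
      by (intro mult_left_mono) auto
    moreover have "real (k - 1 - c) = real k - 1 - real c"
      using False by (simp add: of_nat_diff)
    ultimately have "real k * S \<le> (real c + 1) * sum a H"
      using J(3) by (simp add: algebra_simps)
    moreover have "(real c + 1) * S \<le> (real c + 1) * sum a D"
      using D by (intro mult_left_mono) auto
    ultimately have E: "(real c + 1 + real k) * S \<le> (real c + 1) * sum a E"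
      by (simp add: sumE algebra_simps)
    \<comment> \<open>As \<open>n = c + k\<close>, this amounts to \<open>c + 1 \<le> k\<close>,
      which the case assumption implies. It allows \<open>rho_contract\<close> to replace
      \<open>rho_rank\<close>.\<close>
    have "real k * (real n - 1) \<le> (real k - 1) * (real c + 1 + real k)"
      using False cn by (simp add: algebra_simps)
    then have "real k * (real n - 1) * S \<le> (real k - 1) * (real c + 1 + real k) * S"
      using S_nonneg by (intro mult_right_mono)
    also have "\<dots> \<le> (real k - 1) * ((real c + 1) * sum a E)"
      using E rank_pos by (simp add: mult.assoc mult_left_mono)
    also have "\<dots> = (real k - 1) * (real n - real k + 1) * sum a E"
      by (simp add: cn(1))
    also have "\<dots> \<le> \<rho> * (real n - 1) * sum a E"
      using rho_contract aE by (intro mult_right_mono)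
    finally have "(real n - 1) * (real k * S) \<le> (real n - 1) * (\<rho> * sum a E)"
      by (simp add: algebra_simps)
    moreover have "0 < real n - 1"
      using rank_pos rank_less by linarith
    ultimately show ?thesis
      by (simp add: mult_le_cancel_left_pos)
  qed
qed

text \<open>The contraction of \<open>E - A\<close> has rank \<open>card (B \<inter> A)\<close>, and every basis meets the complement in \<open>A\<close> of
  any smaller set. For \<open>A \<noteq> E\<close> rank or corank drops, whence the two conditions on \<open>\<rho>\<close>.\<close>

lemma weight_contraction:
  assumes A: "A \<subseteq> E" and B: "B \<in> matroid_bases indep"
    and max: "\<And>X. indep X \<Longrightarrow> X \<subseteq> E - A \<Longrightarrow> card X \<le> card (B - A)"
  shows "real (card (B \<inter> A)) * S \<le> \<rho> * sum a A"
proof (cases "A = E \<or> B \<inter> A = {}")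
  case True
  then show ?thesis
  proof
    assume "A = E"
    moreover have "B \<inter> E = B" "card B = k"
      using B basis_subset_ground[OF B] by (auto simp: bases_iff)
    ultimately show ?thesis
      using weight_ground by simp
  next
    assume "B \<inter> A = {}"
    then show ?thesis
      using rho_nonneg A a_nonneg by (auto intro!: mult_nonneg_nonneg sum_nonneg)
  qed
next
  case False
  have finA: "finite A" and finB: "finite B"
    using A finite_ground basis_subset_ground[OF B] by (auto intro: finite_subset)
  define r c where "r = card (B \<inter> A)" and "c = card (A - B)"
  have r: "0 < r"
    using False finA by (simp add: r_def card_gt_0_iff)
  have Bk: "card B = k" "indep B"
    using B by (auto simp: bases_iff)
  have cardA: "card A = r + c"
    using card_Int_Diff[OF finA, of B] by (simp add: r_def c_def Int_commute)
  have cardB: "r + card (B - A) = k"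
    using card_Int_Diff[OF finB, of A] Bk by (simp add: r_def)
  have "card A < n"
    using False A finite_ground by (simp add: psubset_card_mono psubsetI)
  then have rcn: "r + c \<le> n - 1"
    using cardA by simp
  have rk: "r \<le> k"
    using cardB by simp
  have ck: "c \<le> n - k"
  proof -
    have "c \<le> card (E - B)"
      unfolding c_def using A finite_ground by (intro card_mono) auto
    also have "\<dots> = n - k"
      using basis_subset_ground[OF B] finB Bk by (simp add: card_Diff_subset)
    finally show ?thesis .
  qed
  obtain J where J: "J \<subseteq> A" "card J = r - 1" "real (r - 1) * sum a A \<le> real (card A) * sum a J"
    using heavy_subset[OF finA, of "r - 1" a] cardA by (metis diff_le_self le_add1 order_trans)
  have "S \<le> sum a (A - J)"
  proof (rule meets)
    fix B' assume B': "B' \<in> matroid_bases indep"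
    show "(A - J) \<inter> B' \<noteq> {}"
    proof
      assume "(A - J) \<inter> B' = {}"
      \<comment> \<open>By \<open>max\<close> every basis has at least \<open>r\<close> elements in
        \<open>A\<close>, whereas \<open>B'\<close> would have at most
        \<open>card J = r - 1\<close>.\<close>
      then have "B' = (B' - A) \<union> (B' \<inter> J)"
        by auto
      then have "card B' \<le> card (B' - A) + card (B' \<inter> J)"
        by (metis card_Un_le)
      also have "card (B' - A) \<le> card (B - A)"
        using B' basis_subset_ground[OF B'] indep_subset[of B'] by (intro max) (auto simp: bases_iff)
      also have "card (B' \<inter> J) \<le> card J"
        using J finA by (intro card_mono) (auto intro: finite_subset)
      finally show False
        using cardB J(2) r B' by (simp add: bases_iff)
    qed
  qed (use A in auto)
  also have "\<dots> = sum a A - sum a J"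
    using J finA by (simp add: sum_diff)
  finally have "real (card A) * (S + sum a J) \<le> real (card A) * sum a A"
    by (intro mult_left_mono) auto
  then have main: "(real r + real c) * S \<le> (real c + 1) * sum a A"
    using J(3) cardA r by (simp add: algebra_simps of_nat_diff)
  have aA: "0 \<le> sum a A"
    using A a_nonneg by (auto intro!: sum_nonneg)
  have bound: "real r * (real c + 1) \<le> \<rho> * (real r + real c)"
  proof -
    have "real r * (real c + 1) * (real n - 1) \<le> \<rho> * (real n - 1) * (real r + real c)"
    \<comment> \<open>If the rank stays \<open>k\<close>, then \<open>card A < n\<close> forces
      \<open>c \<le> n - k - 1\<close>; otherwise \<open>r \<le> k - 1\<close> and
      \<open>c \<le> n - k\<close>. Monotonicity then leads to \<open>rho_rank\<close> or
      \<open>rho_contract\<close>.\<close>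
    proof (cases "r = k")
      case True
      have "real r * (real c + 1) * (real k + (real n - real k - 1))
          \<le> real k * (real n - real k - 1 + 1) * (real r + real c)"
        using r rcn True by (intro uniform_ratio_mono) linarith+
      also have "\<dots> \<le> \<rho> * (real n - 1) * (real r + real c)"
        using rho_rank by (intro mult_right_mono) auto
      finally show ?thesis
        by (simp add: algebra_simps)
    next
      case False
      have "real r * (real c + 1) * (real k - 1 + (real n - real k))
          \<le> (real k - 1) * (real n - real k + 1) * (real r + real c)"
        using r rk ck rank_less False by (intro uniform_ratio_mono) linarith+
      also have "\<dots> \<le> \<rho> * (real n - 1) * (real r + real c)"
        using rho_contract by (intro mult_right_mono) auto
      finally show ?thesis
        by (simp add: algebra_simps)
    qed
    then have "(real n - 1) * (real r * (real c + 1)) \<le> (real n - 1) * (\<rho> * (real r + real c))"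
      by (simp add: algebra_simps)
    moreover have "0 < real n - 1"
      using rank_pos rank_less by linarith
    ultimately show ?thesis
      by (simp add: mult_le_cancel_left_pos)
  qed
  have "real r * ((real r + real c) * S) \<le> real r * ((real c + 1) * sum a A)"
    using main by (intro mult_left_mono) auto
  also have "\<dots> \<le> \<rho> * (real r + real c) * sum a A"
    using bound aA by (simp add: mult_right_mono flip: mult.assoc)
  finally have "(real r + real c) * (real r * S) \<le> (real r + real c) * (\<rho> * sum a A)"
    by (simp add: algebra_simps)
  then show ?thesis
    using r by (simp add: r_def mult_le_cancel_left_pos)
qed

text \<open>Compare \<open>\<rho> * a\<close> with \<open>S\<close> times the indicator of a basis
  \<open>B\<close> of minimal weight. On each level set of \<open>w\<close> the difference
  \<open>f\<close> has nonnegative sum by \<open>weight_contraction\<close>, hence also against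
  \<open>w\<close>; finally \<open>w\<close> has weight at least 1 on \<open>B\<close>.\<close>

lemma weight_product_bound:
  assumes w: "\<And>e. e \<in> E \<Longrightarrow> 0 \<le> w e" and wB: "\<And>B. B \<in> matroid_bases indep \<Longrightarrow> 1 \<le> sum w B"
  shows "S \<le> \<rho> * (\<Sum>e\<in>E. a e * w e)"
proof -
  obtain B where B: "B \<in> matroid_bases indep"
    and min: "\<And>t X. indep X \<Longrightarrow> X \<subseteq> {e. w e \<le> t} \<Longrightarrow> card X \<le> card (B \<inter> {e. w e \<le> t})"
    using min_weight_basis[of w] by blast
  have BE: "B \<subseteq> E" "finite B"
    using basis_subset_ground[OF B] finite_ground finite_subset by auto
  define f where "f e = \<rho> * a e - S * of_bool (e \<in> B)" for e
  have sumf: "(\<Sum>e\<in>A. g e * f e) = \<rho> * (\<Sum>e\<in>A. a e * g e) - S * sum g (B \<inter> A)" if "A \<subseteq> E" for A g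
  proof -
    have "(\<Sum>e\<in>A. g e * of_bool (e \<in> B)) = sum g (B \<inter> A)"
      using finite_subset[OF that finite_ground]
      by (simp add: of_bool_def if_distrib sum.inter_restrict Int_commute cong: if_cong)
    moreover have "(\<Sum>e\<in>A. g e * f e)
        = (\<Sum>e\<in>A. \<rho> * (a e * g e) - S * (g e * of_bool (e \<in> B)))"
      by (simp add: f_def algebra_simps)
    ultimately show ?thesis
      by (simp only: sum_subtractf sum_distrib_left[symmetric])
  qed
  have "0 \<le> (\<Sum>e\<in>E. w e * f e)"
  proof (rule sum_mult_nonneg_layers[OF finite_ground w])
    fix t :: real assume "0 \<le> t"
    define A where "A = {e \<in> E. t < w e}"
    have "B - A = B \<inter> {e. w e \<le> t}" "E - A \<subseteq> {e. w e \<le> t}"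
      using BE by (auto simp: A_def)
    then have "real (card (B \<inter> A)) * S \<le> \<rho> * sum a A"
      using min[of _ t] B by (intro weight_contraction) (auto simp: A_def)
    then show "0 \<le> sum f {e \<in> E. t < w e}"
      using sumf[of A "\<lambda>_. 1"] by (simp add: A_def mult.commute)
  qed
  then have "S * sum w B \<le> \<rho> * (\<Sum>e\<in>E. a e * w e)"
    using sumf[of E w] BE by (simp add: Int_absorb2)
  moreover have "S * 1 \<le> S * sum w B"
    using wB[OF B] S_nonneg by (intro mult_left_mono)
  ultimately show ?thesis by simp
qed

end

section \<open>Duality and circuits\<close>

definition dual_indep :: "'e set \<Rightarrow> ('e set \<Rightarrow> bool) \<Rightarrow> 'e set \<Rightarrow> bool" where
  "dual_indep E indep X \<longleftrightarrow> X \<subseteq> E \<and> (\<exists>B\<in>matroid_bases indep. X \<inter> B = {})"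

context matroid
begin

text \<open>For augmentation, complete \<open>B2 - X\<close> from \<open>B1\<close> to a basis
  \<open>B\<close>, which still avoids \<open>X\<close>. It cannot contain all of
  \<open>Y - X\<close>: together with \<open>B2 - X\<close> that would exceed the rank, since
  \<open>Y - X\<close> is larger than \<open>X - Y\<close>, which contains
  \<open>B2 \<inter> X\<close>.\<close>

lemma matroid_dual: "matroid E (dual_indep E indep)"
proof
  show "finite E"
    by (rule finite_ground)
  show "dual_indep E indep {}"
    using obtain_basis by (auto simp: dual_indep_def)
  fix X Y
  assume X: "dual_indep E indep X"
  then show "X \<subseteq> E"
    by (simp add: dual_indep_def)
  show "dual_indep E indep Y" if "Y \<subseteq> X"
    using X that by (auto simp: dual_indep_def)
  assume Y: "dual_indep E indep Y" and card: "card X < card Y"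
  obtain B1 B2 where B1: "B1 \<in> matroid_bases indep" "X \<inter> B1 = {}"
    and B2: "B2 \<in> matroid_bases indep" "Y \<inter> B2 = {}"
    using X Y by (auto simp: dual_indep_def)
  have fin: "finite X" "finite Y" "finite B2"
    using X Y basis_subset_ground[OF B2(1)] finite_ground by (auto simp: dual_indep_def intro: finite_subset)
  have "indep (B2 - X)"
    using B2 indep_subset[of B2] by (auto simp: bases_iff)
  then obtain B where B: "indep B" "B2 - X \<subseteq> B" "B \<subseteq> (B2 - X) \<union> B1" "card B = card B1"
    using indep_extend[of "B2 - X" B1] card_indep_le[of "B2 - X"] B1 by (auto simp: bases_iff)
  have basis: "B \<in> matroid_bases indep"
    using B B1 by (simp add: bases_iff)
  have "\<not> Y - X \<subseteq> B"
  proof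
    assume "Y - X \<subseteq> B"
    then have "(Y - X) \<union> (B2 - X) \<subseteq> B"
      using B(2) by blast
    then have "card ((Y - X) \<union> (B2 - X)) \<le> card B"
      using finite_indep[OF B(1)] by (rule card_mono[rotated])
    also have "card ((Y - X) \<union> (B2 - X)) = card (Y - X) + card (B2 - X)"
      using fin B2(2) by (intro card_Un_disjoint) auto
    finally have "card (Y - X) + card (B2 - X) \<le> card B2"
      using B B1 B2 by (simp add: bases_iff)
    moreover have "card B2 = card (B2 \<inter> X) + card (B2 - X)"
      using fin by (rule_tac card_Int_Diff)
    moreover have "card (B2 \<inter> X) \<le> card (X - Y)"
      using fin B2(2) by (intro card_mono) auto
    moreover have "card (X - Y) < card (Y - X)"
      using fin card card_Int_Diff[of X Y] card_Int_Diff[of Y X] by (simp add: Int_commute)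
    ultimately show False
      by linarith
  qed
  then obtain y where "y \<in> Y - X" "y \<notin> B"
    by blast
  moreover from this have "dual_indep E indep (insert y X)"
    using basis B B1 X Y by (auto simp: dual_indep_def)
  ultimately show "\<exists>y\<in>Y - X. dual_indep E indep (insert y X)"
    by blast
qed

lemma bases_dual: "matroid_bases (dual_indep E indep) = (\<lambda>B. E - B) ` matroid_bases indep"
proof (intro equalityI subsetI)
  fix X assume "X \<in> matroid_bases (dual_indep E indep)"
  then have X: "dual_indep E indep X" "\<And>Y. dual_indep E indep Y \<Longrightarrow> X \<subseteq> Y \<Longrightarrow> Y = X"
    by (auto simp: matroid_bases_def)
  then obtain B where B: "B \<in> matroid_bases indep" "X \<inter> B = {}" "X \<subseteq> E"
    by (auto simp: dual_indep_def)
  then have "E - B = X"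
    by (intro X(2)) (auto simp: dual_indep_def)
  with B show "X \<in> (\<lambda>B. E - B) ` matroid_bases indep"
    by blast
next
  fix X assume "X \<in> (\<lambda>B. E - B) ` matroid_bases indep"
  then obtain B where B: "B \<in> matroid_bases indep" "X = E - B"
    by blast
  have "Y = X" if Y: "dual_indep E indep Y" "X \<subseteq> Y" for Y
  proof -
    obtain B' where B': "B' \<in> matroid_bases indep" "Y \<inter> B' = {}" "Y \<subseteq> E"
      using Y by (auto simp: dual_indep_def)
    then have "B' \<subseteq> B"
      using basis_subset_ground[OF B'(1)] B Y by blast
    then have "B = B'"
      using B B' by (auto simp: matroid_bases_def)
    with B B' Y show ?thesis by blast
  qed
  with B show "X \<in> matroid_bases (dual_indep E indep)"
    by (auto simp: matroid_bases_def dual_indep_def)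
qed

lemma rank_dual: "matroid_rank (dual_indep E indep) = card E - matroid_rank indep"
proof -
  interpret dual: matroid E "dual_indep E indep"
    by (rule matroid_dual)
  obtain B where B: "B \<in> matroid_bases indep"
    by (rule obtain_basis)
  then have "E - B \<in> matroid_bases (dual_indep E indep)"
    by (simp add: bases_dual)
  moreover have "card (E - B) = card E - matroid_rank indep"
    using B basis_subset_ground[OF B] by (simp add: card_Diff_subset bases_iff finite_indep)
  ultimately show ?thesis
    by (simp add: dual.bases_iff)
qed

lemma dependent_contains_circuit:
  assumes "X \<subseteq> E" "\<not> indep X"
  shows "\<exists>C\<in>matroid_circuits E indep. C \<subseteq> X"
proof -
  define \<D> where "\<D> = {Y \<in> Pow X. \<not> indep Y}"
  have "finite \<D>" "X \<in> \<D>"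
    using assms finite_subset[OF assms(1) finite_ground] by (auto simp: \<D>_def)
  then obtain C where C: "C \<in> \<D>" "\<forall>D\<in>\<D>. D \<subseteq> C \<longrightarrow> C = D"
    using finite_has_minimal2[of \<D> X] by blast
  then have "indep D" if "D \<subset> C" for D
    using that by (auto simp: \<D>_def)
  with C assms show ?thesis
    by (intro bexI[of _ C]) (auto simp: \<D>_def matroid_circuits_def)
qed

end

text \<open>The two weights of a clutter and its blocker play symmetric roles, so the bound for the circuit
  ideal is the one for the bases of the dual matroid, with \<open>a\<close> and \<open>w\<close> exchanged.\<close>

lemma (in matroid) circuit_weight_product_bound:
  fixes a w :: "'e \<Rightarrow> real"
  defines "r \<equiv> card E - matroid_rank indep"
  assumes H: "H \<subseteq> E" "card H = matroid_rank indep" "H \<notin> matroid_bases indep"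
    and rho_rank: "real r * (real (card E) - real r) \<le> \<rho> * (real (card E) - 1)"
    and rho_contract: "(real r - 1) * (real (card E) - real r + 1) \<le> \<rho> * (real (card E) - 1)"
    and rho: "0 \<le> \<rho>"
    and a: "\<And>e. e \<in> E \<Longrightarrow> 0 \<le> a e" and w: "\<And>e. e \<in> E \<Longrightarrow> 0 \<le> w e"
    and meets: "\<And>T. T \<subseteq> E \<Longrightarrow> (\<And>C. C \<in> matroid_circuits E indep \<Longrightarrow> T \<inter> C \<noteq> {}) \<Longrightarrow> S \<le> sum a T"
    and wC: "\<And>C. C \<in> matroid_circuits E indep \<Longrightarrow> 1 \<le> sum w C"
  shows "S \<le> \<rho> * (\<Sum>e\<in>E. a e * w e)"
\<comment> \<open>The case of positive \<open>S\<close> divides \<open>a\<close> by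
  \<open>S\<close>.\<close>
proof (cases "S \<le> 0")
  case True
  also have "0 \<le> \<rho> * (\<Sum>e\<in>E. a e * w e)"
    using rho a w by (intro mult_nonneg_nonneg sum_nonneg) auto
  finally show ?thesis .
next
  case False
  interpret dual: matroid E "dual_indep E indep"
    by (rule matroid_dual)
  have rank: "matroid_rank (dual_indep E indep) = r"
    by (simp add: rank_dual r_def)
  \<comment> \<open>A set meeting all dual bases lies in no basis, so it is dependent and contains a
    circuit. Hence \<open>w\<close> can take the place of \<open>a\<close>, with bound 1.\<close>
  interpret dual: nonuniform_weighting E "dual_indep E indep" "E - H" w 1 \<rho>
  proof
    show "card (E - H) = matroid_rank (dual_indep E indep)"
      using H finite_subset[OF H(1) finite_ground] by (simp add: rank r_def card_Diff_subset)
    show "E - H \<notin> matroid_bases (dual_indep E indep)"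
    proof
      assume "E - H \<in> matroid_bases (dual_indep E indep)"
      then obtain B where B: "B \<in> matroid_bases indep" "E - H = E - B"
        by (auto simp: bases_dual)
      then have "H = B"
        using H(1) basis_subset_ground[OF B(1)] by blast
      with B H show False by simp
    qed
    fix T assume T: "T \<subseteq> E" "\<And>B. B \<in> matroid_bases (dual_indep E indep) \<Longrightarrow> T \<inter> B \<noteq> {}"
    have "\<not> indep T"
    proof
      assume "indep T"
      obtain B0 where "B0 \<in> matroid_bases indep"
        by (rule obtain_basis)
      then obtain B where "B \<in> matroid_bases indep" "T \<subseteq> B"
        using indep_extend[OF \<open>indep T\<close>, of B0] card_indep_le[OF \<open>indep T\<close>] by (auto simp: bases_iff)
      then show False
        using T(2)[of "E - B"] by (auto simp: bases_dual)
    qed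
    then obtain C where C: "C \<in> matroid_circuits E indep" "C \<subseteq> T"
      using dependent_contains_circuit[OF T(1)] by blast
    have "1 \<le> sum w C"
      by (rule wC[OF C(1)])
    also have "\<dots> \<le> sum w T"
      using C T(1) w finite_subset[OF T(1) finite_ground] by (intro sum_mono2) auto
    finally show "1 \<le> sum w T" .
  qed (use w rho_rank rho_contract in \<open>auto simp: rank\<close>)
  \<comment> \<open>No circuit fits inside a basis, so each dual basis meets all circuits and has
    \<open>a\<close>-weight at least \<open>S\<close>.\<close>
  have "1 \<le> \<rho> * (\<Sum>e\<in>E. w e * (a e / S))"
  proof (rule dual.weight_product_bound)
    fix X assume "X \<in> matroid_bases (dual_indep E indep)"
    then obtain B where B: "B \<in> matroid_bases indep" "X = E - B"
      by (auto simp: bases_dual)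
    have "S \<le> sum a X"
    proof (rule meets)
      fix C assume C: "C \<in> matroid_circuits E indep"
      show "X \<inter> C \<noteq> {}"
      proof
        assume "X \<inter> C = {}"
        then have "C \<subseteq> B"
          using B C by (auto simp: matroid_circuits_def)
        then show False
          using B C indep_subset by (auto simp: bases_iff matroid_circuits_def)
      qed
    qed (use B in blast)
    then show "1 \<le> (\<Sum>e\<in>X. a e / S)"
      using False by (simp add: field_simps flip: sum_divide_distrib)
  qed (use a False in auto)
  also have "(\<Sum>e\<in>E. w e * (a e / S)) = (\<Sum>e\<in>E. a e * w e) / S"
    by (simp add: sum_divide_distrib mult.commute)
  finally show ?thesis
    using False by (simp add: field_simps)
qed

section \<open>Combination of the bounds for both ideals\<close>

theorem corollary5p7:
  fixes E :: "'e set" and indep :: "'e set \<Rightarrow> bool" and n k :: nat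
  assumes "matroid E indep"
    and "\<not> uniform_matroid E indep"
    and "matroid_rank indep = k"
    and "card E = n"
  shows
    "(2 * k \<le> n + 1 \<longrightarrow>
        asymptotic_resurgence (mpoly_ring E) (facet_ideal E indep :: ('e, 'k::field) mpoly set)
          \<le> ereal (real k * (real n - real k) / (real n - 1))) \<and>
     (2 * k \<ge> n + 1 \<longrightarrow>
        asymptotic_resurgence (mpoly_ring E) (facet_ideal E indep :: ('e, 'k) mpoly set)
          \<le> ereal ((real k - 1) * (real n - real k + 1) / (real n - 1))) \<and>
     (n \<le> 2 * k + 1 \<longrightarrow>
        asymptotic_resurgence (mpoly_ring E) (stanley_reisner_ideal E indep :: ('e, 'k) mpoly set)
          \<le> ereal (real k * (real n - real k) / (real n - 1))) \<and>
     (n \<ge> 2 * k + 1 \<longrightarrow>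
        asymptotic_resurgence (mpoly_ring E) (stanley_reisner_ideal E indep :: ('e, 'k) mpoly set)
          \<le> ereal ((real n - real k - 1) * (real k + 1) / (real n - 1)))"
proof -
  interpret matroid E indep
    by fact
  have "matroid_bases indep \<noteq> {B. B \<subseteq> E \<and> card B = k}"
    using assms(2) by (auto simp: uniform_matroid_def)
  moreover have "matroid_bases indep \<subseteq> {B. B \<subseteq> E \<and> card B = k}"
    using assms(3) by (auto simp: bases_iff dest!: indep_subset_ground)
  ultimately obtain H where H: "H \<subseteq> E" "card H = matroid_rank indep" "H \<notin> matroid_bases indep"
    using assms(3) by auto
  have "0 < k" "k < n"
    using nonbasis_rank_bounds[OF H] assms(3,4) by simp_all
  have n1: "0 < real n - 1"
    using \<open>0 < k\<close> \<open>k < n\<close> by linarith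
  \<comment> \<open>Here \<open>x\<close> is any common upper bound of the two numerators, so each
    case of the theorem only has to select the larger one.\<close>
  have facet: "asymptotic_resurgence (mpoly_ring E) (facet_ideal E indep :: ('e, 'k) mpoly set)
      \<le> ereal (x / (real n - 1))"
    if x: "real k * (real n - real k) \<le> x" "(real k - 1) * (real n - real k + 1) \<le> x" for x
    unfolding facet_ideal_def
  proof (rule asymptotic_resurgence_le[OF finite_ground basis_subset_ground])
    have "0 < real k * (real n - real k)"
      using \<open>0 < k\<close> \<open>k < n\<close> by simp
    then show "0 < x / (real n - 1)"
      using x n1 by simp
    fix a w :: "'e \<Rightarrow> real" and S :: real
    assume S: "0 \<le> S" and a: "\<And>e. e \<in> E \<Longrightarrow> 0 \<le> a e" and w: "\<And>e. e \<in> E \<Longrightarrow> 0 \<le> w e"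
      and meets: "\<And>T. T \<subseteq> E \<Longrightarrow> (\<And>B. B \<in> matroid_bases indep \<Longrightarrow> T \<inter> B \<noteq> {}) \<Longrightarrow> S \<le> sum a T"
      and wB: "\<And>B. B \<in> matroid_bases indep \<Longrightarrow> 1 \<le> sum w B"
    interpret nonuniform_weighting E indep H a S "x / (real n - 1)"
      using H a S meets x n1 assms(3,4) by unfold_locales auto
    show "S \<le> x / (real n - 1) * (\<Sum>e\<in>E. a e * w e)"
      using w wB by (rule weight_product_bound)
  qed
  \<comment> \<open>The dual rank is \<open>n - k\<close>: the first numerator is symmetric under
    this exchange, and the second becomes \<open>(n - k - 1) * (k + 1)\<close>.\<close>
  have circuits: "asymptotic_resurgence (mpoly_ring E) (stanley_reisner_ideal E indep :: ('e, 'k) mpoly set)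
      \<le> ereal (x / (real n - 1))"
    if x: "real k * (real n - real k) \<le> x" "(real n - real k - 1) * (real k + 1) \<le> x" for x
    unfolding stanley_reisner_ideal_def
  proof (rule asymptotic_resurgence_le[OF finite_ground])
    show "C \<subseteq> E" if "C \<in> matroid_circuits E indep" for C
      using that by (simp add: matroid_circuits_def)
    have "0 < real k * (real n - real k)"
      using \<open>0 < k\<close> \<open>k < n\<close> by simp
    then show pos: "0 < x / (real n - 1)"
      using x n1 by simp
    fix a w :: "'e \<Rightarrow> real" and S :: real
    assume a: "\<And>e. e \<in> E \<Longrightarrow> 0 \<le> a e" and w: "\<And>e. e \<in> E \<Longrightarrow> 0 \<le> w e"
      and meets: "\<And>T. T \<subseteq> E \<Longrightarrow> (\<And>C. C \<in> matroid_circuits E indep \<Longrightarrow> T \<inter> C \<noteq> {}) \<Longrightarrow> S \<le> sum a T"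
      and wC: "\<And>C. C \<in> matroid_circuits E indep \<Longrightarrow> 1 \<le> sum w C"
    have r: "real (n - k) = real n - real k"
      using \<open>k < n\<close> by simp
    show "S \<le> x / (real n - 1) * (\<Sum>e\<in>E. a e * w e)"
    proof (rule circuit_weight_product_bound[OF H _ _ _ a w meets wC])
      show "real (card E - matroid_rank indep) * (real (card E) - real (card E - matroid_rank indep))
          \<le> x / (real n - 1) * (real (card E) - 1)"
        using x(1) n1 r assms(3,4) by (simp add: mult.commute)
      show "(real (card E - matroid_rank indep) - 1) * (real (card E) - real (card E - matroid_rank indep) + 1)
          \<le> x / (real n - 1) * (real (card E) - 1)"
        using x(2) n1 r assms(3,4) by simp
    qed (use pos in auto)
  qed
  \<comment> \<open>The numerators differ by \<open>2 * k - (n + 1)\<close> and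
    \<open>n - (2 * k + 1)\<close>, so the case conditions decide exactly which one is
    larger.\<close>
  have eq: "(real k - 1) * (real n - real k + 1) = real k * (real n - real k) + (real (2 * k) - real (n + 1))"
    "(real n - real k - 1) * (real k + 1) = real k * (real n - real k) + (real n - real (2 * k + 1))"
    by (simp_all add: algebra_simps)
  have
    "(real k - 1) * (real n - real k + 1) \<le> real k * (real n - real k) \<longleftrightarrow> 2 * k \<le> n + 1"
    "real k * (real n - real k) \<le> (real k - 1) * (real n - real k + 1) \<longleftrightarrow> n + 1 \<le> 2 * k"
    "(real n - real k - 1) * (real k + 1) \<le> real k * (real n - real k) \<longleftrightarrow> n \<le> 2 * k + 1"
    "real k * (real n - real k) \<le> (real n - real k - 1) * (real k + 1) \<longleftrightarrow> 2 * k + 1 \<le> n"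
    by (simp_all only: eq add_le_same_cancel1 le_add_same_cancel1 diff_le_0_iff_le diff_ge_0_iff_ge of_nat_le_iff)
  then show ?thesis
    using facet circuits by blast
qed

end
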